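(* Let $G$ be a planar graph on $n$ vertices. Then the reconfiguration graph $R_{10}(G)$ has diameter at most $8n$; that is, any $10$-coloring of $G$ can be transformed into any other $10$-coloring of $G$ by at most $8n$ single-vertex recolorings, with the coloring being a proper $10$-coloring at every step.
   Context: Graphs are finite and simple. A $k$-coloring of a graph $G$ is a function $\varphi:V(G)\to\{1,\dots,k\}$ such that $\varphi(u)\neq\varphi(v)$ whenever $uv\in E(G)$ (i.e. colorings are proper). The reconfiguration graph $R_k(G)$ has as vertex set the set of all $k$-colorings of $G$, with two colorings adjacent if they differ in the color of exactly one vertex of $G$. *)

theory Defs
  imports "HOL-Analysis.Analysis" "Graph_Theory.Graph_Theory"
begin

text \<open>
  Finite simple graphs are the symmetric digraphs of the locale \<^locale>\<open>graph\<close>: an undirected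
  edge \<open>uv\<close> is the pair of arcs \<open>(u,v)\<close>, \<open>(v,u)\<close>.
\<close>

text \<open>
  Drawings in the plane, which is taken to be \<^typ>\<open>complex\<close>. Curves are indexed by
  two-element sets, so that the two arcs representing an undirected edge share one curve.
  Curves are arbitrary simple arcs, not necessarily polygonal.
\<close>

definition plane_drawing ::
  "('a,'b) pre_digraph \<Rightarrow> ('a \<Rightarrow> complex) \<Rightarrow> ('a set \<Rightarrow> real \<Rightarrow> complex) \<Rightarrow> bool" where
  "plane_drawing G pos \<gamma> \<longleftrightarrow>
     inj_on pos (verts G) \<and>
     (\<forall>u v. u \<rightarrow>\<^bsub>G\<^esub> v \<longrightarrow>
        Path_Connected.arc (\<gamma> {u,v}) \<and>
        {pathstart (\<gamma> {u,v}), pathfinish (\<gamma> {u,v})} = {pos u, pos v} \<and>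
        path_image (\<gamma> {u,v}) \<inter> pos ` verts G = {pos u, pos v}) \<and>
     (\<forall>u v x y. u \<rightarrow>\<^bsub>G\<^esub> v \<longrightarrow> x \<rightarrow>\<^bsub>G\<^esub> y \<longrightarrow> {u,v} \<noteq> {x,y} \<longrightarrow>
        path_image (\<gamma> {u,v}) \<inter> path_image (\<gamma> {x,y}) \<subseteq> pos ` ({u,v} \<inter> {x,y}))"

definition planar_graph :: "('a,'b) pre_digraph \<Rightarrow> bool" where
  "planar_graph G \<longleftrightarrow> graph G \<and> (\<exists>pos \<gamma>. plane_drawing G pos \<gamma>)"

text \<open>
  Colorings are extensional functions (\<open>undefined\<close> outside the vertex set), so that
  functions on the vertex set are represented uniquely.
\<close>

definition colorings :: "nat \<Rightarrow> ('a,'b) pre_digraph \<Rightarrow> ('a \<Rightarrow> nat) set" where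
  "colorings k G =
     {\<phi> \<in> verts G \<rightarrow>\<^sub>E {1..k}. \<forall>u v. u \<rightarrow>\<^bsub>G\<^esub> v \<longrightarrow> \<phi> u \<noteq> \<phi> v}"

definition differ_at_one :: "('a,'b) pre_digraph \<Rightarrow> ('a \<Rightarrow> nat) \<Rightarrow> ('a \<Rightarrow> nat) \<Rightarrow> bool" where
  "differ_at_one G \<phi> \<psi> \<longleftrightarrow> (\<exists>!v. v \<in> verts G \<and> \<phi> v \<noteq> \<psi> v)"

definition reconf_graph ::
  "nat \<Rightarrow> ('a,'b) pre_digraph \<Rightarrow> ('a \<Rightarrow> nat, ('a \<Rightarrow> nat) \<times> ('a \<Rightarrow> nat)) pre_digraph" where
  "reconf_graph k G =
     \<lparr>verts = colorings k G,
      arcs = {(\<phi>,\<psi>). \<phi> \<in> colorings k G \<and> \<psi> \<in> colorings k G \<and> differ_at_one G \<phi> \<psi>},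
      tail = fst, head = snd\<rparr>"

text \<open>
  With unit weights the shortest-path weight \<^const>\<open>wf_digraph.\<mu>\<close> is the graph distance; it is
  infinite between vertices in different components.
\<close>

definition graph_diameter :: "('a,'b) pre_digraph \<Rightarrow> ereal" where
  "graph_diameter H = (SUP u \<in> verts H. SUP v \<in> verts H. wf_digraph.\<mu> H (\<lambda>_. 1) u v)"

lemma graph_reconf_graph:
  assumes "graph G"
  shows "graph (reconf_graph k G)"
proof -
  interpret graph G by fact
  have "colorings k G \<subseteq> verts G \<rightarrow>\<^sub>E {1..k}"
    by (auto simp: colorings_def)
  then have fin: "finite (colorings k G)"
    by (rule finite_subset) (auto intro: finite_PiE)
  moreover have "arcs (reconf_graph k G) \<subseteq> colorings k G \<times> colorings k G"
    by (auto simp: reconf_graph_def)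
  ultimately have "finite (arcs (reconf_graph k G))"
    by (meson finite_SigmaI finite_subset)
  with fin show ?thesis
    by unfold_locales
      (auto simp: reconf_graph_def differ_at_one_def arc_to_ends_def symmetric_conv eq_commute)
qed

end

theory Submission
  imports Defs
begin

text \<open>
  Planarity enters only through density: a drawing excludes \<open>K\<^sub>3\<^sub>,\<^sub>3\<close> minors (three arcs with common
  ends cannot all be reached from one side without crossing them), and a graph on \<open>n \<ge> 2\<close>
  vertices without such a minor has at most \<open>3n - 5\<close> edges, so every nonempty vertex set \<open>S\<close>
  spans fewer than \<open>3|S|\<close> edges. This yields two vertex orders \<open>p\<close>, \<open>q\<close> such that every vertex
  has at most five \<open>p\<close>-later neighbours, and at most eight when its \<open>q\<close>-earlier neighbours are
  added. If new colours are chosen greedily along \<open>q\<close> and installed along \<open>p\<close>, a vertex only has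
  to avoid the old colours of its \<open>p\<close>-later and the new colours of its \<open>q\<close>-earlier neighbours;
  so one pass frees colour 10, which is then given to a maximal independent set \<open>I\<^sub>1\<close>. A second
  pass over the rest frees colour 9 for an independent set \<open>I\<^sub>2\<close>, at a total cost of \<open>2n + |I\<^sub>2|\<close>.
  Doing so from both ends leaves two 8-colourings of the 3-degenerate rest \<open>R\<close>, and these are
  joined with at most four moves per vertex by inserting the vertices one at a time. Altogether
  \<open>4n + 2|I\<^sub>2| + 4|R| \<le> 8n\<close>.
\<close>

section \<open>Two vertex orders from a density bound\<close>

text \<open>Arbitrary arcs give no faces to count, so the edge bound comes from a forbidden minor
  and not from Euler's formula. Excluding \<open>K33\<close> alone is enough: \<open>K5\<close> has
  exactly \<open>3 * 5 - 5\<close> edges, gluing along an edge preserves this value, and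
  \<open>3n - 5\<close> is still below \<open>3n\<close>. A degeneracy order bounds the later
  neighbours by five but not the earlier ones, whose new colours must be avoided too; the second
  order exists to bound the sum by eight, so that nine colours suffice for a full pass. The
  independent sets are not arbitrary maximal ones: every vertex left outside must have a
  \<open>p\<close>-later neighbour inside. Each set then lowers the later degree by one, which takes
  the second pass from nine colours to eight and the later degree from five to three.\<close>

definition nbrs :: "'a rel \<Rightarrow> 'a set \<Rightarrow> 'a \<Rightarrow> 'a set" where
  "nbrs E S v = {u \<in> S. (v, u) \<in> E}"

text \<open>For symmetric \<open>E\<close> this is twice the number of edges induced on
  \<open>S\<close>, so fewer than \<open>3 * card S\<close> edges reads
  \<open>darts E S < 6 * card S\<close>.\<close>

definition darts :: "'a rel \<Rightarrow> 'a set \<Rightarrow> nat" where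
  "darts E S = (\<Sum>v\<in>S. card (nbrs E S v))"

definition ranking :: "('a \<Rightarrow> nat) \<Rightarrow> 'a set \<Rightarrow> bool" where
  "ranking r V \<longleftrightarrow> inj_on r V \<and> (\<forall>v\<in>V. r v < card V)"

lemma finite_nbrs [simp, intro]: "finite S \<Longrightarrow> finite (nbrs E S v)"
  by (simp add: nbrs_def)

lemma nbrs_Un: "nbrs E (S \<union> T) v = nbrs E S v \<union> nbrs E T v"
  by (auto simp: nbrs_def)

lemma card_nbrs_Un:
  "finite S \<Longrightarrow> finite T \<Longrightarrow> S \<inter> T = {} \<Longrightarrow>
    card (nbrs E (S \<union> T) v) = card (nbrs E S v) + card (nbrs E T v)"
  unfolding nbrs_Un by (rule card_Un_disjoint) (auto simp: nbrs_def)

lemma card_nbrs_mono: "finite T \<Longrightarrow> S \<subseteq> T \<Longrightarrow> card (nbrs E S v) \<le> card (nbrs E T v)"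
  by (rule card_mono) (auto simp: nbrs_def)

lemma sum_card_nbrs_swap:
  assumes "sym E" "finite S" "finite T"
  shows "(\<Sum>v\<in>S. card (nbrs E T v)) = (\<Sum>v\<in>T. card (nbrs E S v))"
proof -
  have "(\<Sum>v\<in>S. card (nbrs E T v)) = (\<Sum>v\<in>S. \<Sum>u\<in>T. if (v,u) \<in> E then 1 else 0)"
    by (intro sum.cong refl) (use assms in \<open>simp add: nbrs_def sum.If_cases Int_def\<close>)
  also have "\<dots> = (\<Sum>u\<in>T. \<Sum>v\<in>S. if (v,u) \<in> E then 1 else 0)"
    by (rule sum.swap)
  also have "\<dots> = (\<Sum>u\<in>T. \<Sum>v\<in>S. if (u,v) \<in> E then 1 else 0)"
    using assms(1) by (intro sum.cong refl) (auto dest: symD)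
  also have "\<dots> = (\<Sum>v\<in>T. card (nbrs E S v))"
    by (intro sum.cong refl) (use assms in \<open>simp add: nbrs_def sum.If_cases Int_def\<close>)
  finally show ?thesis .
qed

text \<open>Cross edges have a dart at each end; those at \<open>S\<close> are charged to
  \<open>T\<close>, whence the factor 2. The increment is thus a sum over the added vertices
  alone.\<close>

lemma darts_Un:
  assumes "sym E" "finite S" "finite T" "S \<inter> T = {}"
  shows "darts E (S \<union> T) = darts E S + (\<Sum>v\<in>T. card (nbrs E T v) + 2 * card (nbrs E S v))"
proof -
  have "darts E (S \<union> T) = (\<Sum>v\<in>S. card (nbrs E (S \<union> T) v)) + (\<Sum>v\<in>T. card (nbrs E (S \<union> T) v))"
    unfolding darts_def using assms by (intro sum.union_disjoint) auto
  also have "\<dots> = (\<Sum>v\<in>S. card (nbrs E S v)) + (\<Sum>v\<in>S. card (nbrs E T v)) +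
      ((\<Sum>v\<in>T. card (nbrs E S v)) + (\<Sum>v\<in>T. card (nbrs E T v)))"
    using assms by (simp add: card_nbrs_Un sum.distrib)
  also have "(\<Sum>v\<in>S. card (nbrs E T v)) = (\<Sum>v\<in>T. card (nbrs E S v))"
    by (rule sum_card_nbrs_swap) (use assms in auto)
  finally show ?thesis
    by (simp add: darts_def sum.distrib flip: sum_distrib_left)
qed

text \<open>A vertex picked for \<open>P\<close> is removed and gets the smallest free rank, so the
  set present at its removal, itself included, is the set of ranks at least its own.\<close>

lemma peeling_order:
  assumes "finite L"
    and "\<And>L'. L' \<subseteq> L \<Longrightarrow> L' \<noteq> {} \<Longrightarrow> \<exists>v\<in>L'. P L' v"
  shows "\<exists>r. ranking r L \<and> (\<forall>v\<in>L. P {u\<in>L. r v \<le> r u} v)"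
  using assms
proof (induction "card L" arbitrary: L)
  case 0
  then show ?case by (auto simp: ranking_def)
next
  case (Suc n)
  then obtain v where v: "v \<in> L" "P L v"
    by (metis card.empty nat.distinct(1) order_refl)
  have "n = card (L - {v})"
    using Suc v by simp
  moreover have "\<exists>v\<in>L'. P L' v" if "L' \<subseteq> L - {v}" "L' \<noteq> {}" for L'
    using Suc.prems(2)[of L'] that by blast
  ultimately obtain r where r: "ranking r (L - {v})"
      "\<And>x. x \<in> L - {v} \<Longrightarrow> P {u\<in>L - {v}. r x \<le> r u} x"
    using Suc.hyps(1)[of "L - {v}"] Suc.prems(1) by blast
  define r' where "r' x = (if x = v then 0 else Suc (r x))" for x
  have cL: "card L = Suc (card (L - {v}))"
    using v Suc.prems(1) card_Suc_Diff1[of L v] by simp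
  have "ranking r' L"
    using r(1) cL by (auto simp: ranking_def r'_def inj_on_def)
  moreover have "P {u\<in>L. r' x \<le> r' u} x" if "x \<in> L" for x
  proof (cases "x = v")
    case True
    then have "{u\<in>L. r' x \<le> r' u} = L" by (auto simp: r'_def)
    with True v show ?thesis by simp
  next
    case False
    then have "{u\<in>L. r' x \<le> r' u} = {u\<in>L - {v}. r x \<le> r u}" by (auto simp: r'_def)
    with False r(2)[of x] that show ?thesis by simp
  qed
  ultimately show ?case by blast
qed

lemma ranking_append:
  assumes "ranking r L" "ranking s X" "L \<inter> X = {}" "finite L" "finite X"
  shows "ranking (\<lambda>v. if v \<in> L then r v else card L + s v) (L \<union> X)"
proof -
  have "card (L \<union> X) = card L + card X"
    using assms by (simp add: card_Un_disjoint)
  moreover have "inj_on (\<lambda>v. if v \<in> L then r v else card L + s v) (L \<union> X)"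
  proof (rule inj_on_disjoint_Un)
    show "inj_on r L" "inj_on (\<lambda>v. card L + s v) X"
      using assms(1,2) by (auto simp: ranking_def inj_on_def)
    show "r ` L \<inter> (\<lambda>v. card L + s v) ` X = {}"
      using assms(1) by (force simp: ranking_def)
  qed
  ultimately show ?thesis
    using assms by (auto simp: ranking_def)
qed

text \<open>
  A set \<open>X\<close> maximal for the weighted density below (the whole of \<open>V\<close> fails it) is placed last in
  \<open>p\<close> and first in \<open>q\<close>: adding one vertex, respectively a set, to \<open>X\<close> shows that every vertex of
  \<open>V - X\<close> has \<open>deg\<^sub>V + deg\<^sub>X \<le> 8\<close>, and that \<open>V - X\<close> can be peeled with \<open>deg\<^sub>L + deg\<^sub>X \<le> 5\<close>.
\<close>
lemma two_orders:
  assumes "finite V" "sym E" "irrefl E"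
    and "\<And>S. S \<subseteq> V \<Longrightarrow> S \<noteq> {} \<Longrightarrow> darts E S < 6 * card S"
  shows "\<exists>p q. ranking p V \<and> ranking q V \<and>
    (\<forall>v\<in>V. card (nbrs E {u\<in>V. p v < p u} v) \<le> 5 \<and>
      card (nbrs E {u\<in>V. p v < p u} v) + card (nbrs E {u\<in>V. q u < q v} v) \<le> 8)"
  using assms(1,4)
proof (induction "card V" arbitrary: V rule: less_induct)
  case less
  note fin = \<open>finite V\<close>
  show ?case
  proof (cases "V = {}")
    case True
    then show ?thesis by (auto simp: ranking_def)
  next
    case False
    \<comment> \<open>For \<open>X = V\<close> the right side is \<open>3 * darts E V\<close>, which
      is less than \<open>18 * card V\<close>: the constant 18 is 3 times 6, and it keeps
      \<open>V\<close> from being good.\<close>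
    define good where
      "good X \<longleftrightarrow> X \<subseteq> V \<and> 18 * card X \<le> 2 * (\<Sum>v\<in>X. card (nbrs E V v)) + darts E X" for X
    have "good {}" by (simp add: good_def)
    moreover have "\<forall>X. good X \<longrightarrow> card X < Suc (card V)"
      using fin by (auto simp: good_def intro: card_mono le_imp_less_Suc)
    ultimately obtain X where X: "good X" "\<And>Y. good Y \<Longrightarrow> card Y \<le> card X"
      using ex_has_greatest_nat[of good "{}" card "Suc (card V)"] by blast
    have XV: "X \<subseteq> V" and finX: "finite X"
      using X(1) fin finite_subset by (auto simp: good_def)
    define L where "L = V - X"
    have finL: "finite L" and VXL: "V = X \<union> L" "X \<inter> L = {}"
      using fin XV by (auto simp: L_def)
    have "X \<noteq> V"
      using X(1) less.prems(2)[of V] False by (auto simp: good_def darts_def)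
    then have cX: "card X < card V" and "L \<noteq> {}"
      using XV fin by (auto simp: L_def psubset_card_mono)
    \<comment> \<open>Adding \<open>L'\<close> raises the right side of \<open>good\<close> by the
      sum of these weights; if all reached 18, the union of \<open>X\<close> and \<open>L'\<close>
      would be a larger good set.\<close>
    have improve: "\<exists>v\<in>L'. 2 * card (nbrs E V v) + card (nbrs E L' v) + 2 * card (nbrs E X v) < 18"
      if L': "L' \<subseteq> L" "L' \<noteq> {}" for L'
    proof (rule ccontr)
      assume "\<not> ?thesis"
      then have ge: "18 \<le> 2 * card (nbrs E V v) + (card (nbrs E L' v) + 2 * card (nbrs E X v))"
        if "v \<in> L'" for v
        using that by force
      have fL': "finite L'" "X \<inter> L' = {}"
        using L' finL VXL finite_subset by auto
      have "18 * card L' \<le> (\<Sum>v\<in>L'. 2 * card (nbrs E V v) + (card (nbrs E L' v) + 2 * card (nbrs E X v)))"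
        using sum_mono[of L' "\<lambda>_. 18", OF ge] by (simp add: mult.commute)
      also have "\<dots> = 2 * (\<Sum>v\<in>L'. card (nbrs E V v)) + (\<Sum>v\<in>L'. card (nbrs E L' v) + 2 * card (nbrs E X v))"
        by (simp add: sum.distrib flip: sum_distrib_left)
      finally have "good (X \<union> L')"
        using X(1) L' VXL finX fL'
        by (simp add: good_def darts_Un[OF assms(2)] card_Un_disjoint sum.union_disjoint) auto
      then have "card X + card L' \<le> card X"
        using X(2)[of "X \<union> L'"] finX fL' by (simp add: card_Un_disjoint)
      then show False
        using fL' L'(2) by simp
    qed
    have deg8: "card (nbrs E V v) + card (nbrs E X v) \<le> 8" if "v \<in> L" for v
      using improve[of "{v}"] that by auto
    have deg5: "\<exists>v\<in>L'. card (nbrs E L' v) + card (nbrs E X v) \<le> 5" if L': "L' \<subseteq> L" "L' \<noteq> {}" for L'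
    proof -
      obtain v where v: "v \<in> L'"
        "2 * card (nbrs E V v) + card (nbrs E L' v) + 2 * card (nbrs E X v) < 18"
        using improve[OF L'] by blast
      \<comment> \<open>This split bounds the weight below by 3 times the degree in
        \<open>L'\<close> plus 4 times the degree in \<open>X\<close>; less than 18 forces their sum
        to be at most 5.\<close>
      have "card (nbrs E V v) = card (nbrs E L v) + card (nbrs E X v)"
        unfolding VXL(1) using finX finL VXL(2) by (simp add: card_nbrs_Un)
      moreover have "card (nbrs E L' v) \<le> card (nbrs E L v)"
        using finL L' by (intro card_nbrs_mono)
      ultimately show ?thesis
        using v by (intro bexI[of _ v]) auto
    qed
    obtain r where r: "ranking r L"
      "\<And>v. v \<in> L \<Longrightarrow> card (nbrs E {u\<in>L. r v \<le> r u} v) + card (nbrs E X v) \<le> 5"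
      using peeling_order[OF finL deg5] by blast
    obtain p q where pq: "ranking p X" "ranking q X"
      "\<And>v. v \<in> X \<Longrightarrow> card (nbrs E {u\<in>X. p v < p u} v) \<le> 5"
      "\<And>v. v \<in> X \<Longrightarrow> card (nbrs E {u\<in>X. p v < p u} v) + card (nbrs E {u\<in>X. q u < q v} v) \<le> 8"
    proof -
      have "darts E S < 6 * card S" if "S \<subseteq> X" "S \<noteq> {}" for S
        using less.prems(2)[of S] that XV by blast
      from less.hyps[OF cX finX this] show ?thesis
        using that by blast
    qed
    define p' where "p' = (\<lambda>v. if v \<in> L then r v else card L + p v)"
    define q' where "q' = (\<lambda>v. if v \<in> X then q v else card X + r v)"
    have cV: "card V = card X + card L"
      using VXL finX finL by (simp add: card_Un_disjoint)
    have p': "ranking p' V"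
      using ranking_append[OF r(1) pq(1)] VXL finX finL
      by (simp add: p'_def Un_commute[of L] Int_commute[of L])
    have q': "ranking q' V"
      using ranking_append[OF pq(2) r(1)] VXL finX finL by (simp add: q'_def)
    have "card (nbrs E {u\<in>V. p' v < p' u} v) \<le> 5 \<and>
      card (nbrs E {u\<in>V. p' v < p' u} v) + card (nbrs E {u\<in>V. q' u < q' v} v) \<le> 8" if "v \<in> V" for v
    proof (cases "v \<in> L")
      case True
      \<comment> \<open>\<open>X\<close> comes after \<open>v\<close> in \<open>p'\<close> and
        before it in \<open>q'\<close>, so neighbours in \<open>X\<close> count twice; both orders
        use \<open>r\<close> on \<open>L\<close>, so a neighbour in \<open>L\<close> counts once.
        The sum is at most the degree in \<open>V\<close> plus the degree in
        \<open>X\<close>.\<close>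
      have "{u\<in>V. p' v < p' u} = {u\<in>L. r v < r u} \<union> X"
        using True VXL r(1) by (auto simp: p'_def ranking_def)
      moreover have "{u\<in>L. r v < r u} \<inter> X = {}"
        using VXL(2) by auto
      ultimately have P: "card (nbrs E {u\<in>V. p' v < p' u} v)
        = card (nbrs E {u\<in>L. r v < r u} v) + card (nbrs E X v)"
        using finL finX by (simp add: card_nbrs_Un)
      have "{u\<in>V. q' u < q' v} = {u\<in>L. r u < r v} \<union> X"
        using True VXL pq(2) by (auto simp: q'_def ranking_def)
      moreover have "{u\<in>L. r u < r v} \<inter> X = {}"
        using VXL(2) by auto
      ultimately have Q: "card (nbrs E {u\<in>V. q' u < q' v} v)
        = card (nbrs E {u\<in>L. r u < r v} v) + card (nbrs E X v)"
        using finL finX by (simp add: card_nbrs_Un)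
      have "card (nbrs E {u\<in>L. r v < r u} v) \<le> card (nbrs E {u\<in>L. r v \<le> r u} v)"
        using finL by (intro card_nbrs_mono) auto
      with r(2)[OF True] P have "card (nbrs E {u\<in>V. p' v < p' u} v) \<le> 5"
        by linarith
      moreover have "card (nbrs E {u\<in>L. r v < r u} v) + card (nbrs E {u\<in>L. r u < r v} v)
        = card (nbrs E ({u\<in>L. r v < r u} \<union> {u\<in>L. r u < r v}) v)"
        using finL by (intro card_nbrs_Un[symmetric]) auto
      moreover have "\<dots> \<le> card (nbrs E L v)"
        using finL by (intro card_nbrs_mono) auto
      moreover have "card (nbrs E V v) = card (nbrs E L v) + card (nbrs E X v)"
        unfolding VXL(1) using finX finL VXL(2) by (simp add: card_nbrs_Un)
      ultimately show ?thesis
        using deg8[OF True] P Q by linarith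
    next
      case False
      then have vX: "v \<in> X" using that VXL by auto
      have "{u\<in>V. p' v < p' u} = {u\<in>X. p v < p u}"
        using False VXL r(1) by (auto simp: p'_def ranking_def)
      moreover have "{u\<in>V. q' u < q' v} = {u\<in>X. q u < q v}"
        using vX VXL pq(2) by (auto simp: q'_def ranking_def)
      ultimately show ?thesis
        using pq(3,4)[OF vX] by simp
    qed
    with p' q' show ?thesis by blast
  qed
qed

section \<open>Recolouring rounds\<close>

text \<open>A set with a relation instead of a digraph record: induced subgraphs and contractions
  are then instances over the same vertex type.\<close>

locale finite_graph =
  fixes V :: "'a set" and E :: "'a rel"
  assumes finV: "finite V" and EV: "E \<subseteq> V \<times> V" and symE: "sym E" and irreflE: "irrefl E"
begin

lemma E_sym: "(u, v) \<in> E \<Longrightarrow> (v, u) \<in> E"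
  using symE by (auto dest: symD)

lemma E_irrefl [simp]: "(v, v) \<notin> E"
  using irreflE by (auto simp: irrefl_def)

definition cols :: "nat \<Rightarrow> ('a \<Rightarrow> nat) set" where
  "cols k = {\<phi> \<in> V \<rightarrow>\<^sub>E {1..k}. \<forall>u v. (u, v) \<in> E \<longrightarrow> \<phi> u \<noteq> \<phi> v}"

text \<open>The index is only an upper bound on the number of moves, and a move may repeat the old
  colour; a round costs \<open>card D\<close> without a check of which colours really
  change.\<close>

inductive reach :: "nat \<Rightarrow> nat \<Rightarrow> ('a \<Rightarrow> nat) \<Rightarrow> ('a \<Rightarrow> nat) \<Rightarrow> bool" for k where
  refl: "\<phi> \<in> cols k \<Longrightarrow> reach k m \<phi> \<phi>"
| step: "reach k m \<phi> \<psi> \<Longrightarrow> v \<in> V \<Longrightarrow> \<psi>' = \<psi>(v := c) \<Longrightarrow> \<psi>' \<in> cols k \<Longrightarrow> reach k (Suc m) \<phi> \<psi>'"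

lemma reach_cols: "reach k m \<phi> \<psi> \<Longrightarrow> \<phi> \<in> cols k \<and> \<psi> \<in> cols k"
  by (induction rule: reach.induct) blast+

lemma reach_mono: "reach k m \<phi> \<psi> \<Longrightarrow> m \<le> m' \<Longrightarrow> reach k m' \<phi> \<psi>"
proof (induction arbitrary: m' rule: reach.induct)
  case (refl \<phi> m)
  then show ?case by (auto intro: reach.refl)
next
  case (step m \<phi> \<psi> v \<psi>' c)
  then obtain n where "m' = Suc n" "m \<le> n" by (cases m') auto
  with step show ?case by (blast intro: reach.step)
qed

lemma reach_trans: "reach k b \<psi> \<theta> \<Longrightarrow> reach k a \<phi> \<psi> \<Longrightarrow> reach k (a + b) \<phi> \<theta>"
proof (induction rule: reach.induct)
  case (refl \<psi> m)
  from refl(2) show ?case by (rule reach_mono) simp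
next
  case (step m \<psi> \<psi>' v \<psi>'' c)
  then have "reach k (a + m) \<phi> \<psi>'" by blast
  then have "reach k (Suc (a + m)) \<phi> \<psi>''"
    using step.hyps by (intro reach.step)
  then show ?case by simp
qed

lemma reach_sym: "reach k m \<phi> \<psi> \<Longrightarrow> reach k m \<psi> \<phi>"
proof (induction rule: reach.induct)
  case (refl \<phi> m)
  then show ?case by (rule reach.refl)
next
  case (step m \<phi> \<psi> v \<psi>' c)
  have "\<psi> = \<psi>'(v := \<psi> v)" "\<psi> \<in> cols k"
    using step reach_cols[OF step.IH] by auto
  with step have "reach k (Suc 0) \<psi>' \<psi>"
    by (intro reach.step[of k 0 \<psi>' \<psi>'] reach.refl)
  then show ?case
    using reach_trans[OF step.IH, of "Suc 0" \<psi>'] by simp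
qed

text \<open>Recolour \<open>D\<close> in increasing \<open>p\<close>. At the turn of
  \<open>v\<close>, its \<open>p\<close>-earlier neighbours in \<open>D\<close> already wear
  \<open>\<gamma>\<close> and all others still wear \<open>\<alpha>\<close>, so the last two
  assumptions cover every conflict.\<close>

lemma reach_round:
  assumes "\<alpha> \<in> cols k" "D \<subseteq> V" "ranking p V"
    and "\<And>v. v \<in> D \<Longrightarrow> \<gamma> v \<in> {1..k}"
    and "\<And>u v. u \<in> D \<Longrightarrow> v \<in> D \<Longrightarrow> (u, v) \<in> E \<Longrightarrow> \<gamma> u \<noteq> \<gamma> v"
    and "\<And>u v. v \<in> D \<Longrightarrow> u \<in> V \<Longrightarrow> (v, u) \<in> E \<Longrightarrow> u \<notin> D \<or> p v < p u \<Longrightarrow> \<gamma> v \<noteq> \<alpha> u"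
  shows "reach k (card D) \<alpha> (\<lambda>v. if v \<in> D then \<gamma> v else \<alpha> v)"
proof -
  define B where "B j = {v\<in>D. p v < j}" for j
  define \<psi> where "\<psi> j = (\<lambda>v. if v \<in> B j then \<gamma> v else \<alpha> v)" for j
  have \<alpha>: "\<alpha> \<in> extensional V" "\<And>v. v \<in> V \<Longrightarrow> \<alpha> v \<in> {1..k}" "\<And>u v. (u, v) \<in> E \<Longrightarrow> \<alpha> u \<noteq> \<alpha> v"
    using assms(1) by (auto simp: cols_def PiE_def)
  have ne: "\<psi> j u \<noteq> \<psi> j v" if e: "(u, v) \<in> E" for u v j
  proof -
    have uv: "u \<in> V" "v \<in> V" using e EV by auto
    have *: "\<gamma> x \<noteq> \<alpha> y" if "x \<in> B j" "y \<notin> B j" "(x, y) \<in> E" for x y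
      using that assms(6)[of x y] EV by (auto simp: B_def)
    show ?thesis
      using *[of u v] *[of v u] e E_sym[OF e] assms(5)[of u v] \<alpha>(3)[of u v]
      by (auto simp: \<psi>_def B_def)
  qed
  have cols: "\<psi> j \<in> cols k" for j
  proof -
    have "\<psi> j \<in> extensional V"
      using \<alpha>(1) assms(2) by (auto simp: \<psi>_def B_def extensional_def)
    moreover have "\<psi> j v \<in> {1..k}" if "v \<in> V" for v
      using assms(4)[of v] \<alpha>(2)[OF that] by (auto simp: \<psi>_def B_def)
    ultimately show ?thesis
      using ne by (auto simp: cols_def PiE_def)
  qed
  have finD: "finite D" using assms(2) finV finite_subset by blast
  have "reach k (card (B j)) \<alpha> (\<psi> j)" for j
  proof (induction j)
    case 0
    have "\<psi> 0 = \<alpha>" by (auto simp: \<psi>_def B_def)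
    with assms(1) show ?case by (auto intro: reach.refl)
  next
    case (Suc j)
    show ?case
    proof (cases "\<exists>v\<in>D. p v = j")
      case True
      then obtain v where v: "v \<in> D" "p v = j" by blast
      have B: "B (Suc j) = insert v (B j)" "v \<notin> B j"
        using v assms(2,3) by (auto simp: B_def less_Suc_eq ranking_def inj_on_def)
      then have "\<psi> (Suc j) = (\<psi> j)(v := \<gamma> v)"
        by (auto simp: \<psi>_def)
      with Suc.IH cols[of "Suc j"] v assms(2) have "reach k (Suc (card (B j))) \<alpha> (\<psi> (Suc j))"
        by (intro reach.step[of k _ \<alpha> "\<psi> j"]) auto
      moreover have "card (B (Suc j)) = Suc (card (B j))"
        using B finD by (simp add: B_def)
      ultimately show ?thesis by simp
    next
      case False
      then have "B (Suc j) = B j" by (auto simp: B_def less_Suc_eq)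
      with Suc.IH show ?thesis by (simp add: \<psi>_def)
    qed
  qed
  moreover have "B (card V) = D"
    using assms(2,3) by (auto simp: B_def ranking_def)
  ultimately have "reach k (card D) \<alpha> (\<psi> (card V))"
    by metis
  then show ?thesis
    using \<open>B (card V) = D\<close> by (simp add: \<psi>_def)
qed

text \<open>Choosing in increasing \<open>q\<close>, only \<open>q\<close>-earlier neighbours
  already have new colours. The set \<open>B v\<close> is fixed beforehand, which makes the order of
  choice independent of the order of the moves.\<close>

lemma greedy_choice:
  fixes q :: "'a \<Rightarrow> nat"
  assumes "finite D" "finite A" "inj_on q D"
    and "\<And>v. v \<in> D \<Longrightarrow> finite (B v)"
    and "\<And>v. v \<in> D \<Longrightarrow> card (B v) + card (nbrs E {u\<in>D. q u < q v} v) < card A"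
  shows "\<exists>\<gamma>::'a \<Rightarrow> nat. \<forall>v\<in>D. \<gamma> v \<in> A - B v \<and> (\<forall>u\<in>D. (v, u) \<in> E \<longrightarrow> \<gamma> v \<noteq> \<gamma> u)"
  using assms(1,3-)
proof (induction D rule: finite_ranking_induct[where f = q])
  case empty
  then show ?case by simp
next
  case (insert x S)
  show ?case
  proof (cases "x \<in> S")
    case True
    then show ?thesis using insert by (simp add: insert_absorb)
  next
    case False
    have less: "q u < q x" if "u \<in> S" for u
      using insert.hyps(2)[OF that] insert.prems(1) that False by (auto simp: inj_on_def le_less)
    have "card (nbrs E {u\<in>S. q u < q v} v) \<le> card (nbrs E {u\<in>insert x S. q u < q v} v)" for v
      using insert.hyps(1) by (intro card_nbrs_mono) auto
    then have "\<exists>\<gamma>. \<forall>v\<in>S. \<gamma> v \<in> A - B v \<and> (\<forall>u\<in>S. (v, u) \<in> E \<longrightarrow> \<gamma> v \<noteq> \<gamma> u)"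
      using insert.prems by (intro insert.IH) (auto intro: le_less_trans add_left_mono)
    then obtain \<gamma> where \<gamma>: "\<And>v. v \<in> S \<Longrightarrow> \<gamma> v \<in> A - B v"
      "\<And>u v. u \<in> S \<Longrightarrow> v \<in> S \<Longrightarrow> (v, u) \<in> E \<Longrightarrow> \<gamma> v \<noteq> \<gamma> u" by metis
    have eq: "{u\<in>insert x S. q u < q x} = S" using less by auto
    have "card (B x \<union> \<gamma> ` nbrs E S x) \<le> card (B x) + card (nbrs E S x)"
      using insert.hyps(1) by (meson add_left_mono card_Un_le card_image_le finite_nbrs le_trans)
    then have "card (B x \<union> \<gamma> ` nbrs E S x) < card A"
      using insert.prems(3)[of x] unfolding eq by simp
    moreover have "finite (B x \<union> \<gamma> ` nbrs E S x)"
      using insert by auto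
    ultimately obtain c where c: "c \<in> A" "c \<notin> B x \<union> \<gamma> ` nbrs E S x"
      by (meson card_mono leD subsetI)
    have "(\<gamma>(x := c)) v \<in> A - B v \<and> (\<forall>u\<in>insert x S. (v, u) \<in> E \<longrightarrow> (\<gamma>(x := c)) v \<noteq> (\<gamma>(x := c)) u)"
      if "v \<in> insert x S" for v
      using that c \<gamma> False E_sym[of v x] by (auto simp: nbrs_def image_iff)
    then show ?thesis by blast
  qed
qed

text \<open>Colours outside \<open>D\<close> avoid the palette \<open>A\<close>, so neighbours there
  never obstruct and the count runs over \<open>D\<close> only.\<close>

lemma recolour_round:
  assumes "\<alpha> \<in> cols k" "D \<subseteq> V" "ranking p V" "ranking q V" "A \<subseteq> {1..k}"
    and "\<And>v. v \<in> V - D \<Longrightarrow> \<alpha> v \<notin> A"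
    and "\<And>v. v \<in> D \<Longrightarrow>
      card (nbrs E {u\<in>D. p v < p u} v) + card (nbrs E {u\<in>D. q u < q v} v) < card A"
  shows "\<exists>\<beta>. reach k (card D) \<alpha> \<beta> \<and> (\<forall>v\<in>D. \<beta> v \<in> A) \<and> (\<forall>v. v \<notin> D \<longrightarrow> \<beta> v = \<alpha> v)"
proof -
  have finD: "finite D" using assms(2) finV finite_subset by blast
  have "\<exists>\<gamma>. \<forall>v\<in>D. \<gamma> v \<in> A - \<alpha> ` nbrs E {u\<in>D. p v < p u} v \<and>
    (\<forall>u\<in>D. (v, u) \<in> E \<longrightarrow> \<gamma> v \<noteq> \<gamma> u)"
  proof (rule greedy_choice)
    show "finite A" using assms(5) finite_subset by blast
    show "inj_on q D" using assms(2,4) inj_on_subset by (auto simp: ranking_def)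
    show "card (\<alpha> ` nbrs E {u\<in>D. p v < p u} v) + card (nbrs E {u\<in>D. q u < q v} v) < card A"
      if "v \<in> D" for v
      using assms(7)[OF that] card_image_le[of "nbrs E {u\<in>D. p v < p u} v" \<alpha>] finD by simp
  qed (use finD in auto)
  then obtain \<gamma> where \<gamma>: "\<And>v. v \<in> D \<Longrightarrow> \<gamma> v \<in> A - \<alpha> ` nbrs E {u\<in>D. p v < p u} v"
    "\<And>u v. u \<in> D \<Longrightarrow> v \<in> D \<Longrightarrow> (v, u) \<in> E \<Longrightarrow> \<gamma> v \<noteq> \<gamma> u" by metis
  have "reach k (card D) \<alpha> (\<lambda>v. if v \<in> D then \<gamma> v else \<alpha> v)"
  proof (rule reach_round)
    show "\<gamma> v \<noteq> \<alpha> u" if "v \<in> D" "u \<in> V" "(v, u) \<in> E" "u \<notin> D \<or> p v < p u" for u v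
    proof (cases "u \<in> D")
      case True
      then have "u \<in> nbrs E {u\<in>D. p v < p u} v" using that by (auto simp: nbrs_def)
      with \<gamma>(1)[OF that(1)] show ?thesis by auto
    next
      case False
      with assms(6)[of u] \<gamma>(1)[OF that(1)] that(2) show ?thesis by auto
    qed
    show "\<gamma> v \<in> {1..k}" if "v \<in> D" for v
      using \<gamma>(1)[OF that] assms(5) by auto
  qed (use \<gamma>(2) assms in auto)
  with \<gamma>(1) show ?thesis
    by (intro exI[of _ "\<lambda>v. if v \<in> D then \<gamma> v else \<alpha> v"]) auto
qed

text \<open>A kernel, in the digraph sense, of the orientation towards \<open>p\<close>-later
  vertices. Mere maximality would only give a neighbour on some side, which need not lower the
  \<open>p\<close>-later degree.\<close>

definition kernel :: "('a \<Rightarrow> nat) \<Rightarrow> 'a set \<Rightarrow> 'a set \<Rightarrow> bool" where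
  "kernel p D I \<longleftrightarrow> I \<subseteq> D \<and> (\<forall>u\<in>I. \<forall>v\<in>I. (u, v) \<notin> E) \<and>
    (\<forall>v\<in>D - I. \<exists>u\<in>I. (v, u) \<in> E \<and> p v < p u)"

text \<open>Scan from the \<open>p\<close>-last vertex down, hence the negated rank: the new vertex
  precedes all of \<open>S\<close> and joins \<open>I\<close> unless a neighbour, necessarily
  \<open>p\<close>-later, is already there.\<close>

lemma kernel_exists:
  assumes "finite D" "inj_on p D"
  shows "\<exists>I. kernel p D I"
  using assms
proof (induction D rule: finite_ranking_induct[where f = "\<lambda>v. - int (p v)"])
  case empty
  then show ?case by (auto simp: kernel_def)
next
  case (insert x S)
  show ?case
  proof (cases "x \<in> S")
    case True
    then show ?thesis using insert by (simp add: insert_absorb)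
  next
    case False
    have less: "p x < p u" if "u \<in> S" for u
      using insert.hyps(2)[OF that] insert.prems(1) that False by (auto simp: inj_on_def le_less)
    obtain I where I: "kernel p S I" using insert.IH insert.prems by auto
    show ?thesis
    proof (cases "\<exists>u\<in>I. (x, u) \<in> E")
      case True
      with I less have "kernel p (insert x S) I"
        by (fastforce simp: kernel_def)
      then show ?thesis by blast
    next
      case F: False
      then have "kernel p (insert x S) (insert x I)"
        using I E_sym by (fastforce simp: kernel_def)
      then show ?thesis by blast
    qed
  qed
qed

lemma park:
  assumes "\<alpha> \<in> cols k" "I \<subseteq> V" "ranking p V" "c \<in> {1..k}"
    and "\<forall>u\<in>I. \<forall>v\<in>I. (u, v) \<notin> E" "\<And>v. v \<in> V \<Longrightarrow> \<alpha> v \<noteq> c"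
  shows "reach k (card I) \<alpha> (\<lambda>v. if v \<in> I then c else \<alpha> v)"
  by (rule reach_round[where p = p]) (use assms in auto)

text \<open>The \<open>p\<close>-later neighbour \<open>w\<close> that absorbs \<open>v\<close> lies
  in the kernel and drops out of the count.\<close>

lemma later_nbrs_outside_kernel:
  assumes "kernel p D I" "finite D" "v \<in> D - I"
  shows "Suc (card (nbrs E {u\<in>D - I. p v < p u} v)) \<le> card (nbrs E {u\<in>D. p v < p u} v)"
proof -
  obtain w where w: "w \<in> I" "(v, w) \<in> E" "p v < p w"
    using assms(1,3) unfolding kernel_def by blast
  have wD: "w \<in> D" using w(1) assms(1) by (auto simp: kernel_def)
  have "card (insert w (nbrs E {u\<in>D - I. p v < p u} v)) \<le> card (nbrs E {u\<in>D. p v < p u} v)"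
    using assms(2) w wD by (intro card_mono) (auto simp: nbrs_def)
  moreover have "w \<notin> nbrs E {u\<in>D - I. p v < p u} v"
    using w by (auto simp: nbrs_def)
  ultimately show ?thesis using assms(2) by simp
qed

text \<open>Which vertices end with 10 or 9 depends only on the kernels, so two colourings parked
  this way differ at most on the rest, where only eight colours occur.\<close>

lemma reach_parked:
  assumes "ranking p V" "ranking q V"
    and le8: "\<And>v. v \<in> V \<Longrightarrow>
      card (nbrs E {u\<in>V. p v < p u} v) + card (nbrs E {u\<in>V. q u < q v} v) \<le> 8"
    and I1: "kernel p V I1" and I2: "kernel p (V - I1) I2"
    and \<alpha>: "\<alpha> \<in> cols 10"
  shows "\<exists>\<beta>. reach 10 (2 * card V + card I2) \<alpha> \<beta> \<and> (\<forall>v\<in>I1. \<beta> v = 10) \<and>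
    (\<forall>v\<in>I2. \<beta> v = 9) \<and> (\<forall>v\<in>V - I1 - I2. \<beta> v \<in> {1..8})"
proof -
  have sub: "I1 \<subseteq> V" "I2 \<subseteq> V - I1" using I1 I2 by (auto simp: kernel_def)
  \<comment> \<open>At most eight colours are forbidden, so nine suffice and 10 becomes free on all
    of \<open>V\<close>.\<close>
  obtain \<alpha>1 where \<alpha>1: "reach 10 (card V) \<alpha> \<alpha>1" "\<forall>v\<in>V. \<alpha>1 v \<in> {1..9}"
    using recolour_round[OF \<alpha> order_refl assms(1,2), of "{1..9}"] le_imp_less_Suc[OF le8]
    by fastforce
  define \<alpha>2 where "\<alpha>2 = (\<lambda>v. if v \<in> I1 then 10 else \<alpha>1 v)"
  have \<alpha>2: "reach 10 (card I1) \<alpha>1 \<alpha>2"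
    unfolding \<alpha>2_def using reach_cols[OF \<alpha>1(1)] assms(1) sub I1 \<alpha>1(2)
    by (intro park) (auto simp: kernel_def)
  \<comment> \<open>Outside \<open>I1\<close> one \<open>p\<close>-later neighbour is lost, so the
    sum falls from 8 to 7 and eight colours suffice.\<close>
  have lt: "card (nbrs E {u\<in>V - I1. p v < p u} v) + card (nbrs E {u\<in>V - I1. q u < q v} v) < card {1..8::nat}"
    if v: "v \<in> V - I1" for v
  proof -
    have "card (nbrs E {u\<in>V - I1. q u < q v} v) \<le> card (nbrs E {u\<in>V. q u < q v} v)"
      using finV by (intro card_nbrs_mono) auto
    with later_nbrs_outside_kernel[OF I1 finV v] le8[of v] v show ?thesis by simp
  qed
  \<comment> \<open>\<open>I1\<close> wears 10, outside the palette, and stays fixed; afterwards 9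
    is used nowhere.\<close>
  obtain \<alpha>3 where \<alpha>3: "reach 10 (card (V - I1)) \<alpha>2 \<alpha>3" "\<forall>v\<in>V - I1. \<alpha>3 v \<in> {1..8}"
    "\<forall>v. v \<notin> V - I1 \<longrightarrow> \<alpha>3 v = \<alpha>2 v"
    using recolour_round[OF _ _ assms(1,2) _ _ lt, of \<alpha>2 10] reach_cols[OF \<alpha>2] sub
    by (auto simp: \<alpha>2_def double_diff)
  define \<alpha>4 where "\<alpha>4 = (\<lambda>v. if v \<in> I2 then 9 else \<alpha>3 v)"
  have \<alpha>4: "reach 10 (card I2) \<alpha>3 \<alpha>4"
    unfolding \<alpha>4_def
  proof (rule park)
    show "\<alpha>3 v \<noteq> 9" if "v \<in> V" for v
      using that \<alpha>3(2,3) by (cases "v \<in> I1") (force simp: \<alpha>2_def)+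
  qed (use reach_cols[OF \<alpha>3(1)] assms(1) sub I2 in \<open>auto simp: kernel_def\<close>)
  have "reach 10 (card V + card I1 + card (V - I1) + card I2) \<alpha> \<alpha>4"
    by (rule reach_trans[OF \<alpha>4 reach_trans[OF \<alpha>3(1) reach_trans[OF \<alpha>2 \<alpha>1(1)]]])
  moreover have "card I1 + card (V - I1) = card V"
    using sub finV by (metis card_Diff_subset card_mono finite_subset le_add_diff_inverse)
  ultimately have "reach 10 (2 * card V + card I2) \<alpha> \<alpha>4"
    by (simp add: add.assoc mult_2)
  moreover have "\<forall>v\<in>I1. \<alpha>4 v = 10"
    using sub \<alpha>3(3) by (auto simp: \<alpha>4_def \<alpha>2_def)
  ultimately show ?thesis
    using \<alpha>3(2) by (intro exI[of _ \<alpha>4]) (auto simp: \<alpha>4_def)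
qed

end

section \<open>Eight-colourings of 3-degenerate graphs\<close>

context finite_graph
begin

section \<open>Move sequences on an induced subgraph\<close>

definition proper8 :: "'a set \<Rightarrow> ('a \<Rightarrow> nat) \<Rightarrow> bool" where
  "proper8 S \<phi> \<longleftrightarrow> (\<forall>v\<in>S. \<phi> v \<in> {1..8}) \<and> (\<forall>u\<in>S. \<forall>v\<in>S. (u, v) \<in> E \<longrightarrow> \<phi> u \<noteq> \<phi> v)"

text \<open>Explicit move lists, since \<open>reach\<close> forgets its moves: inserting a vertex
  means interleaving extra moves and bounding the moves of each vertex separately.\<close>

fun run :: "('a \<Rightarrow> nat) \<Rightarrow> ('a \<times> nat) list \<Rightarrow> 'a \<Rightarrow> nat" where
  "run \<phi> [] = \<phi>"
| "run \<phi> ((v, c) # ms) = run (\<phi>(v := c)) ms"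

fun valid :: "'a set \<Rightarrow> ('a \<Rightarrow> nat) \<Rightarrow> ('a \<times> nat) list \<Rightarrow> bool" where
  "valid S \<phi> [] = proper8 S \<phi>"
| "valid S \<phi> ((v, c) # ms) \<longleftrightarrow> proper8 S \<phi> \<and> v \<in> S \<and> valid S (\<phi>(v := c)) ms"

definition count :: "'a \<Rightarrow> ('a \<times> nat) list \<Rightarrow> nat" where
  "count v ms = length (filter (\<lambda>m. fst m = v) ms)"

definition colours_on :: "'a set \<Rightarrow> ('a \<times> nat) list \<Rightarrow> nat list" where
  "colours_on N ms = map snd (filter (\<lambda>m. fst m \<in> N) ms)"

lemma valid_proper8: "valid S \<phi> ms \<Longrightarrow> proper8 S \<phi>"
  by (cases "(S, \<phi>, ms)" rule: valid.cases) auto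

lemma valid_cong: "valid S \<phi> ms \<Longrightarrow> (\<And>v. v \<in> S \<Longrightarrow> \<phi> v = \<phi>' v) \<Longrightarrow> valid S \<phi>' ms"
proof (induction ms arbitrary: \<phi> \<phi>')
  case Nil
  then show ?case by (auto simp: proper8_def)
next
  case (Cons m ms)
  obtain w c where m: "m = (w, c)" by fastforce
  have "valid S (\<phi>'(w := c)) ms"
  proof (rule Cons.IH)
    show "valid S (\<phi>(w := c)) ms"
      using Cons.prems(1) m by simp
    show "(\<phi>(w := c)) v = (\<phi>'(w := c)) v" if "v \<in> S" for v
      using Cons.prems(2)[OF that] by simp
  qed
  moreover have "proper8 S \<phi>'"
    using Cons.prems m by (auto simp: proper8_def)
  ultimately show ?case
    using Cons.prems(1) m by simp
qed

lemma valid_append_move: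
  "valid S \<phi> ms \<Longrightarrow> v \<in> S \<Longrightarrow> proper8 S ((run \<phi> ms)(v := c)) \<Longrightarrow> valid S \<phi> (ms @ [(v, c)])"
  by (induction ms arbitrary: \<phi>) auto

lemma run_append: "run \<phi> (ms @ ms') = run (run \<phi> ms) ms'"
  by (induction ms arbitrary: \<phi>) auto

lemma run_outside: "valid S \<phi> ms \<Longrightarrow> v \<notin> S \<Longrightarrow> run \<phi> ms v = \<phi> v"
  by (induction ms arbitrary: \<phi>) auto

lemma run_filter:
  "(\<And>u. u \<noteq> v \<Longrightarrow> \<phi> u = \<phi>' u) \<Longrightarrow> u \<noteq> v \<Longrightarrow>
    run \<phi> ms u = run \<phi>' (filter (\<lambda>m. fst m \<noteq> v) ms) u"
proof (induction ms arbitrary: \<phi> \<phi>')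
  case (Cons m ms)
  obtain w c where m: "m = (w, c)" by fastforce
  show ?case
  proof (cases "w = v")
    case True
    have "run (\<phi>(w := c)) ms u = run \<phi>' (filter (\<lambda>m. fst m \<noteq> v) ms) u"
      using Cons.prems True by (intro Cons.IH) auto
    with True m show ?thesis by simp
  next
    case False
    have "run (\<phi>(w := c)) ms u = run (\<phi>'(w := c)) (filter (\<lambda>m. fst m \<noteq> v) ms) u"
      using Cons.prems by (intro Cons.IH) auto
    with False m show ?thesis by simp
  qed
qed simp

lemma length_colours_on:
  "finite N \<Longrightarrow> length (colours_on N ms) = (\<Sum>u\<in>N. count u ms)"
proof (induction ms)
  case (Cons m ms)
  have "(\<Sum>u\<in>N. count u (m # ms)) = (\<Sum>u\<in>N. (if u = fst m then 1 else 0) + count u ms)"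
    by (intro sum.cong) (auto simp: count_def)
  then show ?case
    using Cons by (auto simp: colours_on_def sum.distrib sum.If_cases Int_insert_right)
qed (simp add: colours_on_def count_def)

lemma filter_neq_count:
  assumes "filter (\<lambda>m. fst m \<noteq> v) ms' = ms" "u \<noteq> v"
  shows "count u ms' = count u ms"
  unfolding count_def assms(1)[symmetric] filter_filter
  by (intro arg_cong[where f = length] filter_cong) (use assms(2) in auto)

lemma proper8_insert_update:
  assumes "proper8 (insert v S) \<phi>" "proper8 S (\<phi>(w := c))" "w \<in> S" "v \<notin> S"
    and "(v, w) \<in> E \<Longrightarrow> c \<noteq> \<phi> v"
  shows "proper8 (insert v S) (\<phi>(w := c))"
  using assms E_sym[of w v] unfolding proper8_def by (auto split: if_splits)

lemma proper8_recolour: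
  assumes "proper8 (insert v S) \<phi>" "c \<in> {1..8}" "v \<notin> S" "c \<notin> \<phi> ` nbrs E S v"
  shows "proper8 (insert v S) (\<phi>(v := c))"
  using assms E_sym unfolding proper8_def nbrs_def by (auto simp: image_iff)

text \<open>
  The induction invariant is that the current colour of \<open>v\<close> does not occur among the next \<open>j\<close>
  colours given to neighbours of \<open>v\<close>. When \<open>v\<close> blocks a move, one of the eight colours avoids
  the at most three colours on its neighbours and the next four colours given to them.
\<close>
lemma insert_vertex_moves:
  assumes "valid S \<phi> ms" "proper8 (insert v S) \<phi>" "v \<notin> S" "finite S" "card (nbrs E S v) \<le> 3"
    and "\<phi> v \<notin> set (take j (colours_on (nbrs E S v) ms))"
  shows "\<exists>ms'. valid (insert v S) \<phi> ms' \<and> filter (\<lambda>m. fst m \<noteq> v) ms' = ms \<and>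
    count v ms' \<le> (length (colours_on (nbrs E S v) ms) + 3 - j) div 4"
  using assms
proof (induction ms arbitrary: \<phi> j)
  case Nil
  then show ?case by (intro exI[of _ "[]"]) (auto simp: count_def)
next
  case (Cons m ms)
  obtain w c where m: "m = (w, c)" by fastforce
  define N where "N = nbrs E S v"
  define T where "T = length (colours_on N ms)"
  have w: "w \<in> S" "w \<noteq> v" "valid S (\<phi>(w := c)) ms"
    using Cons.prems(1,3) m by auto
  have p: "proper8 S (\<phi>(w := c))" using valid_proper8[OF w(3)] .
  have cN: "card N \<le> 3" using Cons.prems(5) by (simp add: N_def)
  note IH = Cons.IH[folded N_def T_def]
  \<comment> \<open>The case in which \<open>v\<close> need not move. Here \<open>i\<close> counts
    the upcoming neighbour colours still known to be harmless: \<open>j\<close> if the move misses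
    \<open>N\<close>, \<open>j - 1\<close> if it uses one up.\<close>
  have extend: "\<exists>ms'. valid (insert v S) \<phi> ms' \<and> filter (\<lambda>m. fst m \<noteq> v) ms' = m # ms \<and> count v ms' \<le> b"
    if h: "c \<noteq> \<phi> v \<or> w \<notin> N" "\<phi> v \<notin> set (take i (colours_on N ms))" "(T + 3 - i) div 4 \<le> b" for i b
  proof -
    have "proper8 (insert v S) (\<phi>(w := c))"
      using Cons.prems(2,3) p w(1) h(1)
      by (intro proper8_insert_update) (auto simp: N_def nbrs_def)
    moreover have "(\<phi>(w := c)) v \<notin> set (take i (colours_on N ms))"
      using h(2) w(2) by simp
    ultimately obtain ms' where ms': "valid (insert v S) (\<phi>(w := c)) ms'"
      "filter (\<lambda>m. fst m \<noteq> v) ms' = ms" "count v ms' \<le> (T + 3 - i) div 4"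
      using IH[OF w(3) _ Cons.prems(3,4) cN] by blast
    show ?thesis
      using ms' m w(1,2) Cons.prems(2) h(3)
      by (intro exI[of _ "m # ms'"]) (auto simp: count_def)
  qed
  show ?case
  proof (cases "w \<in> N")
    case False
    then have "colours_on N (m # ms) = colours_on N ms"
      by (simp add: colours_on_def m)
    then show ?thesis
      using extend[of j "(T + 3 - j) div 4"] False Cons.prems(6) by (simp add: N_def T_def)
  next
    case True
    then have cs: "colours_on N (m # ms) = c # colours_on N ms"
      by (simp add: colours_on_def m)
    show ?thesis
    proof (cases "c = \<phi> v")
      case False
      have "(T + 3 - (j - 1)) div 4 \<le> (Suc T + 3 - j) div 4"
        by (intro div_le_mono) auto
      moreover have "\<phi> v \<notin> set (take (j - 1) (colours_on N ms))"
        using Cons.prems(6) cs by (cases j) (auto simp: N_def)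
      ultimately show ?thesis
        using extend[of "j - 1" "(Suc T + 3 - j) div 4"] False cs by (simp add: N_def T_def)
    next
      case True
      \<comment> \<open>A positive \<open>j\<close> would already exclude \<open>c\<close> as the
        colour of \<open>v\<close>; a block occurs only when the guarantee is exhausted.\<close>
      then have j: "j = 0"
        using Cons.prems(6) cs by (cases j) (auto simp: N_def)
      have "card (\<phi> ` N \<union> set (take 4 (colours_on N (m # ms)))) \<le> 3 + 4"
      proof (intro order_trans[OF card_Un_le] add_mono)
        show "card (\<phi> ` N) \<le> 3"
          using Cons.prems(4,5) card_image_le[of N \<phi>] by (simp add: N_def)
        show "card (set (take 4 (colours_on N (m # ms)))) \<le> 4"
          by (rule order_trans[OF card_length]) simp
      qed
      also have "\<dots> < card {1..8::nat}" by simp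
      finally have "\<not> {1..8} \<subseteq> \<phi> ` N \<union> set (take 4 (colours_on N (m # ms)))"
        using Cons.prems(4) by (auto simp: N_def dest!: card_mono[rotated])
      then obtain c' where c': "c' \<in> {1..8}" "c' \<notin> \<phi> ` N"
        "c' \<notin> set (take 4 (colours_on N (m # ms)))" by blast
      then have c'': "c' \<noteq> c" "c' \<notin> set (take 3 (colours_on N ms))"
        by (auto simp: cs numeral_eq_Suc)
      have 1: "proper8 (insert v S) (\<phi>(v := c'))"
        using c' Cons.prems(2,3) by (intro proper8_recolour) (auto simp: N_def)
      have 2: "valid S (\<phi>(v := c', w := c)) ms"
        using Cons.prems(3) w(2,3) by (auto intro: valid_cong)
      have 3: "proper8 (insert v S) (\<phi>(v := c', w := c))"
        using proper8_insert_update[OF 1 valid_proper8[OF 2] w(1) Cons.prems(3)] c''(1) by simp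
      have 4: "(\<phi>(v := c', w := c)) v \<notin> set (take 3 (colours_on N ms))"
        using c''(2) w(2) by simp
      \<comment> \<open>The blocking move is the first of the four dodged colours, so the guarantee
        resumes with 3, and \<open>T + 3 - 3\<close> leaves at most \<open>T div 4\<close> further
        moves of \<open>v\<close>.\<close>
      obtain ms' where ms': "valid (insert v S) (\<phi>(v := c', w := c)) ms'"
        "filter (\<lambda>m. fst m \<noteq> v) ms' = ms" "count v ms' \<le> T div 4"
        using IH[OF 2 3 Cons.prems(3,4) cN 4] unfolding add_diff_cancel_right' by blast
      have "count v ((v, c') # m # ms') \<le> Suc (T div 4)"
        using ms'(3) m w(2) by (simp add: count_def)
      also have "Suc (T div 4) = (length (colours_on N (m # ms)) + 3 - j) div 4"
        using cs j by (simp add: T_def)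
      finally show ?thesis
        using ms'(1,2) 1 Cons.prems(2) m w(1,2)
        by (intro exI[of _ "(v, c') # m # ms'"]) (simp add: N_def)
    qed
  qed
qed

text \<open>Inserting in decreasing \<open>p\<close>, a new vertex meets at most three neighbours.
  They make at most 12 moves, which force at most \<open>(12 + 3) div 4 = 3\<close> moves on it; a
  fourth gives it its target colour once all others have theirs, so the bound 4 reproduces
  itself.\<close>

lemma degenerate_moves:
  fixes p :: "'a \<Rightarrow> nat"
  assumes "finite S" "inj_on p S"
    and "\<And>v. v \<in> S \<Longrightarrow> card (nbrs E {u\<in>S. p v < p u} v) \<le> 3"
    and "proper8 S \<phi>" "proper8 S \<psi>"
  shows "\<exists>ms. valid S \<phi> ms \<and> (\<forall>v\<in>S. run \<phi> ms v = \<psi> v) \<and> (\<forall>v. count v ms \<le> 4)"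
  using assms
proof (induction S rule: finite_ranking_induct[where f = "\<lambda>v. - int (p v)"])
  case empty
  then show ?case by (intro exI[of _ "[]"]) (auto simp: count_def)
next
  case (insert x S)
  show ?case
  proof (cases "x \<in> S")
    case True
    then show ?thesis using insert by (simp add: insert_absorb)
  next
    case False
    have less: "p x < p u" if "u \<in> S" for u
      using insert.hyps(2)[OF that] insert.prems(1) that False by (auto simp: inj_on_def le_less)
    have "card (nbrs E {u\<in>S. p v < p u} v) \<le> card (nbrs E {u\<in>insert x S. p v < p u} v)" for v
      using insert.hyps(1) by (intro card_nbrs_mono) auto
    then have "card (nbrs E {u\<in>S. p v < p u} v) \<le> 3" if "v \<in> S" for v
      using insert.prems(2)[of v] that by (meson insertI2 order_trans)
    moreover have "proper8 S \<phi>" "proper8 S \<psi>"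
      using insert.prems(3,4) by (auto simp: proper8_def)
    ultimately obtain ms where ms: "valid S \<phi> ms" "\<And>v. v \<in> S \<Longrightarrow> run \<phi> ms v = \<psi> v"
      "\<And>v. count v ms \<le> 4"
      using insert.IH insert.prems(1) by auto
    have "{u\<in>insert x S. p x < p u} = S" using less by auto
    then have c3: "card (nbrs E S x) \<le> 3" using insert.prems(2)[of x] by simp
    obtain ms' where ms': "valid (insert x S) \<phi> ms'" "filter (\<lambda>m. fst m \<noteq> x) ms' = ms"
      "count x ms' \<le> (length (colours_on (nbrs E S x) ms) + 3) div 4"
      using insert_vertex_moves[OF ms(1) insert.prems(3) False insert.hyps(1) c3, of 0] by auto
    have "length (colours_on (nbrs E S x) ms) \<le> 12"
    proof -
      have "(\<Sum>u\<in>nbrs E S x. count u ms) \<le> card (nbrs E S x) * 4"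
        using sum_bounded_above[of "nbrs E S x" "\<lambda>u. count u ms" 4] ms(3) by simp
      also have "\<dots> \<le> 12" using c3 by simp
      finally show ?thesis using insert.hyps(1) by (simp add: length_colours_on)
    qed
    then have cx: "count x ms' \<le> 3" using ms'(3) by linarith
    define ms'' where "ms'' = ms' @ [(x, \<psi> x)]"
    have run': "run \<phi> ms' u = \<psi> u" if "u \<in> S" for u
      using run_filter[of x \<phi> \<phi> u ms'] ms'(2) ms(2)[OF that] that False by auto
    have "proper8 (insert x S) ((run \<phi> ms')(x := \<psi> x))"
      using insert.prems(4) run' False unfolding proper8_def by auto
    then have "valid (insert x S) \<phi> ms''"
      unfolding ms''_def using ms'(1) by (intro valid_append_move) auto
    moreover have "run \<phi> ms'' v = \<psi> v" if "v \<in> insert x S" for v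
      using that run' by (auto simp: ms''_def run_append)
    moreover have "count v ms'' \<le> 4" for v
      using cx ms(3)[of v] filter_neq_count[OF ms'(2), of v]
      by (cases "v = x") (auto simp: ms''_def count_def)
    ultimately show ?thesis by blast
  qed
qed

text \<open>Outside \<open>S\<close> only colours beyond 8 occur and inside only colours up to 8, so
  no conflict crosses the boundary.\<close>

lemma valid_reach:
  assumes "valid S \<phi> ms" "\<phi> \<in> cols 10" "S \<subseteq> V" "\<And>v. v \<in> V - S \<Longrightarrow> \<phi> v \<notin> {1..8}"
  shows "reach 10 (length ms) \<phi> (run \<phi> ms)"
  using assms
proof (induction ms arbitrary: \<phi>)
  case Nil
  then show ?case by (auto intro: reach.refl)
next
  case (Cons m ms)
  obtain v c where m: "m = (v, c)" by fastforce
  define \<phi>' where "\<phi>' = \<phi>(v := c)"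
  have v: "v \<in> S" "valid S \<phi>' ms" "v \<in> V" using Cons.prems m by (auto simp: \<phi>'_def)
  note p = valid_proper8[OF v(2)]
  have \<phi>: "\<phi> \<in> extensional V" "\<And>v. v \<in> V \<Longrightarrow> \<phi> v \<in> {1..10}" "\<And>u v. (u, v) \<in> E \<Longrightarrow> \<phi> u \<noteq> \<phi> v"
    using Cons.prems(2) by (auto simp: cols_def PiE_def)
  have out: "\<phi>' u = \<phi> u" if "u \<notin> S" for u using that v(1) by (auto simp: \<phi>'_def)
  have ins: "\<phi>' u \<in> {1..8}" if "u \<in> S" for u using p that by (auto simp: proper8_def)
  have "\<phi>' \<in> extensional V" using \<phi>(1) v(3) by (auto simp: \<phi>'_def extensional_def)
  moreover have "\<phi>' u \<in> {1..10}" if "u \<in> V" for u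
    using ins[of u] out[of u] \<phi>(2)[OF that] by (cases "u \<in> S") auto
  moreover have "\<phi>' u \<noteq> \<phi>' w" if e: "(u, w) \<in> E" for u w
  proof -
    have uw: "u \<in> V" "w \<in> V" using e EV by auto
    show ?thesis
    proof (cases "u \<in> S"; cases "w \<in> S")
      assume "u \<in> S" "w \<in> S" then show ?thesis using p e by (auto simp: proper8_def)
    next
      assume "u \<in> S" "w \<notin> S" then show ?thesis using ins[of u] out[of w] Cons.prems(4)[of w] uw by auto
    next
      assume "u \<notin> S" "w \<in> S" then show ?thesis using ins[of w] out[of u] Cons.prems(4)[of u] uw by auto
    next
      assume "u \<notin> S" "w \<notin> S" then show ?thesis using \<phi>(3)[OF e] out by auto
    qed
  qed
  ultimately have c: "\<phi>' \<in> cols 10" by (auto simp: cols_def PiE_def)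
  have "reach 10 (Suc 0) \<phi> \<phi>'"
    using Cons.prems(2) c v(3) \<phi>'_def by (intro reach.step[of 10 0 \<phi> \<phi>] reach.refl)
  moreover have "reach 10 (length ms) \<phi>' (run \<phi>' ms)"
  proof (rule Cons.IH)
    show "\<phi>' u \<notin> {1..8}" if "u \<in> V - S" for u
      using that out[of u] Cons.prems(4)[of u] by simp
  qed (use v c Cons.prems(3) in auto)
  ultimately show ?case
    using reach_trans[of 10 "length ms" \<phi>' _ "Suc 0" \<phi>] by (simp add: \<phi>'_def m)
qed

lemma length_moves:
  assumes "valid S \<phi> ms" "finite S"
  shows "length ms = (\<Sum>v\<in>S. count v ms)"
proof -
  have "fst ` set ms \<subseteq> S"
    using assms(1)
  proof (induction ms arbitrary: \<phi>)
    case (Cons m ms)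
    obtain v c where m: "m = (v, c)" by fastforce
    have "valid S (\<phi>(v := c)) ms" "v \<in> S"
      using Cons.prems by (simp_all only: m valid.simps)
    with Cons.IH m show ?case by auto
  qed simp
  then have "filter (\<lambda>m. fst m \<in> S) ms = ms"
    by (auto simp: filter_id_conv)
  then show ?thesis
    using length_colours_on[OF assms(2), of ms] by (simp add: colours_on_def)
qed

theorem reach_8n:
  assumes "\<And>S. S \<subseteq> V \<Longrightarrow> S \<noteq> {} \<Longrightarrow> darts E S < 6 * card S"
    and \<alpha>: "\<alpha> \<in> cols 10" and \<beta>: "\<beta> \<in> cols 10"
  shows "reach 10 (8 * card V) \<alpha> \<beta>"
proof -
  obtain p q where pq: "ranking p V" "ranking q V"
    "\<And>v. v \<in> V \<Longrightarrow> card (nbrs E {u\<in>V. p v < p u} v) \<le> 5"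
    "\<And>v. v \<in> V \<Longrightarrow> card (nbrs E {u\<in>V. p v < p u} v) + card (nbrs E {u\<in>V. q u < q v} v) \<le> 8"
    using two_orders[OF finV symE irreflE assms(1)] by blast
  have inj: "inj_on p V" using pq(1) by (simp add: ranking_def)
  obtain I1 where I1: "kernel p V I1" using kernel_exists[OF finV inj] by blast
  obtain I2 where I2: "kernel p (V - I1) I2"
    using kernel_exists[OF finite_Diff[OF finV] inj_on_subset[OF inj Diff_subset]] by blast
  define R where "R = V - I1 - I2"
  have sub: "I1 \<subseteq> V" "I2 \<subseteq> V - I1" and finR: "finite R" "R \<subseteq> V"
    using I1 I2 finV by (auto simp: kernel_def R_def)
  obtain \<alpha>' where \<alpha>': "reach 10 (2 * card V + card I2) \<alpha> \<alpha>'"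
    "\<forall>v\<in>I1. \<alpha>' v = 10" "\<forall>v\<in>I2. \<alpha>' v = 9" "\<forall>v\<in>R. \<alpha>' v \<in> {1..8}"
    using reach_parked[OF pq(1,2,4) I1 I2 \<alpha>] unfolding R_def by blast
  obtain \<beta>' where \<beta>': "reach 10 (2 * card V + card I2) \<beta> \<beta>'"
    "\<forall>v\<in>I1. \<beta>' v = 10" "\<forall>v\<in>I2. \<beta>' v = 9" "\<forall>v\<in>R. \<beta>' v \<in> {1..8}"
    using reach_parked[OF pq(1,2,4) I1 I2 \<beta>] unfolding R_def by blast
  have cols: "\<alpha>' \<in> cols 10" "\<beta>' \<in> cols 10"
    using reach_cols \<alpha>'(1) \<beta>'(1) by blast+
  \<comment> \<open>Each kernel takes away one later neighbour: 5, then 4, then 3.\<close>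
  have "card (nbrs E {u\<in>R. p v < p u} v) \<le> 3" if "v \<in> R" for v
    using later_nbrs_outside_kernel[OF I1 finV, of v] later_nbrs_outside_kernel[OF I2, of v]
      finV pq(3)[of v] that by (auto simp: R_def)
  moreover have "proper8 R \<alpha>'" "proper8 R \<beta>'"
    using cols \<alpha>'(4) \<beta>'(4) by (auto simp: proper8_def cols_def)
  moreover have "inj_on p R" by (rule inj_on_subset[OF inj finR(2)])
  ultimately obtain ms where ms: "valid R \<alpha>' ms" "\<forall>v\<in>R. run \<alpha>' ms v = \<beta>' v" "\<forall>v. count v ms \<le> 4"
    using degenerate_moves[OF finR(1)] by blast
  \<comment> \<open>Equality of functions is needed: on the kernels both wear 10 or 9, and off
    \<open>V\<close> both are \<open>undefined\<close>.\<close>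
  have "run \<alpha>' ms v = \<beta>' v" for v
  proof (cases "v \<in> R")
    case True
    with ms(2) show ?thesis by simp
  next
    case False
    then consider "v \<in> I1" | "v \<in> I2" | "v \<notin> V" by (auto simp: R_def)
    then have "\<alpha>' v = \<beta>' v"
      using \<alpha>'(2,3) \<beta>'(2,3) cols by cases (auto simp: cols_def PiE_def extensional_def)
    with run_outside[OF ms(1) False] show ?thesis by simp
  qed
  then have "run \<alpha>' ms = \<beta>'" by blast
  moreover have "reach 10 (length ms) \<alpha>' (run \<alpha>' ms)"
    using ms(1) cols(1) finR(2)
  proof (rule valid_reach)
    show "\<alpha>' v \<notin> {1..8}" if "v \<in> V - R" for v
    proof -
      from that have "v \<in> I1 \<or> v \<in> I2" by (auto simp: R_def)
      then have "\<alpha>' v = 10 \<or> \<alpha>' v = 9" using \<alpha>'(2,3) by blast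
      then show ?thesis by auto
    qed
  qed
  ultimately have "reach 10 (2 * card V + card I2 + length ms + (2 * card V + card I2)) \<alpha> \<beta>"
    using reach_trans[OF reach_sym[OF \<beta>'(1)] reach_trans[OF _ \<alpha>'(1)]] by simp
  moreover have "length ms \<le> 4 * card R"
    using length_moves[OF ms(1) finR(1)] sum_bounded_above[of R "\<lambda>v. count v ms" 4] ms(3) by simp
  moreover have "card R + card I2 \<le> card V"
  proof -
    have "card (R \<union> I2) = card R + card I2"
      using finV sub by (intro card_Un_disjoint) (auto simp: R_def intro: finite_subset)
    moreover have "card (R \<union> I2) \<le> card V"
      using finV sub by (intro card_mono) (auto simp: R_def)
    ultimately show ?thesis by simp
  qed
  ultimately show ?thesis
    by (elim reach_mono) linarith
qed

end

section \<open>Graphs without a K33 minor\<close>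

text \<open>Connectedness is defined by cuts, so that it lifts along contractions without any path surgery.\<close>

definition conn :: "'a rel \<Rightarrow> 'a set \<Rightarrow> bool" where
  "conn F S \<longleftrightarrow> S \<noteq> {} \<and> (\<forall>T\<subseteq>S. T \<noteq> {} \<longrightarrow> T \<noteq> S \<longrightarrow> (\<exists>a\<in>T. \<exists>b\<in>S - T. (a, b) \<in> F))"

definition touching :: "'a rel \<Rightarrow> 'a set \<Rightarrow> 'a set \<Rightarrow> bool" where
  "touching F A B \<longleftrightarrow> (\<exists>a\<in>A. \<exists>b\<in>B. (a, b) \<in> F)"

definition k33_model :: "'a set \<Rightarrow> 'a rel \<Rightarrow> (nat \<Rightarrow> 'a set) \<Rightarrow> (nat \<Rightarrow> 'a set) \<Rightarrow> bool" where
  "k33_model V F A B \<longleftrightarrow>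
    (\<forall>i<3. A i \<subseteq> V \<and> conn F (A i) \<and> B i \<subseteq> V \<and> conn F (B i)) \<and>
    (\<forall>i<3. \<forall>j<3. i \<noteq> j \<longrightarrow> A i \<inter> A j = {} \<and> B i \<inter> B j = {}) \<and>
    (\<forall>i<3. \<forall>j<3. A i \<inter> B j = {} \<and> touching F (A i) (B j))"

definition k33_minor :: "'a set \<Rightarrow> 'a rel \<Rightarrow> bool" where
  "k33_minor V F \<longleftrightarrow> (\<exists>A B. k33_model V F A B)"

lemma conn_singleton [simp]: "conn F {x}"
  by (auto simp: conn_def subset_singleton_iff)

lemma conn_mono: "conn F S \<Longrightarrow> F \<subseteq> F' \<Longrightarrow> conn F' S"
  unfolding conn_def by blast

lemma k33_minor_mono:
  assumes "k33_minor V F" "V \<subseteq> V'" "F \<subseteq> F'"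
  shows "k33_minor V' F'"
proof -
  obtain A B where AB: "k33_model V F A B"
    using assms(1) by (auto simp: k33_minor_def)
  have "touching F' X Y" if "touching F X Y" for X Y
    using that assms(3) by (auto simp: touching_def)
  then have "k33_model V' F' A B"
    using AB assms(2) conn_mono[OF _ assms(3)] unfolding k33_model_def
    by (metis order_trans)
  then show ?thesis by (auto simp: k33_minor_def)
qed

lemma all_less_3: "(\<forall>i<3. P i) \<longleftrightarrow> P 0 \<and> P 1 \<and> P (2::nat)"
  by (auto simp: less_Suc_eq numeral_eq_Suc)

text \<open>The shape of both models found in dense graphs: one connected branch set, all others
  single vertices.\<close>

lemma k33_minorI:
  assumes "conn F A" "A \<subseteq> V" "v \<in> V" "w \<in> V" "a \<in> V" "b \<in> V" "c \<in> V"
    and "distinct [v, w, a, b, c]" "v \<notin> A" "w \<notin> A" "a \<notin> A" "b \<notin> A" "c \<notin> A"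
    and "\<And>x. x \<in> {a, b, c} \<Longrightarrow> touching F A {x} \<and> (v, x) \<in> F \<and> (w, x) \<in> F"
  shows "k33_minor V F"
proof -
  define X where "X = (\<lambda>i::nat. if i = 0 then A else if i = 1 then {v} else {w})"
  define Y where "Y = (\<lambda>i::nat. if i = 0 then {a} else if i = 1 then {b} else {c})"
  have X: "X 0 = A" "X 1 = {v}" "X 2 = {w}" and Y: "Y 0 = {a}" "Y 1 = {b}" "Y 2 = {c}"
    by (auto simp: X_def Y_def)
  have T: "touching F A {a}" "touching F A {b}" "touching F A {c}"
    "touching F {v} {a}" "touching F {v} {b}" "touching F {v} {c}"
    "touching F {w} {a}" "touching F {w} {b}" "touching F {w} {c}"
    using assms(14) by (auto simp: touching_def)
  have "k33_model V F X Y"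
    unfolding k33_model_def all_less_3 X Y using T assms(1-13) by auto
  then show ?thesis by (auto simp: k33_minor_def)
qed

context finite_graph
begin

section \<open>Removing a vertex and contracting an edge\<close>

lemma finE: "finite E"
  using finite_subset[OF EV] finV by simp

lemma finite_graph_subset:
  assumes "W \<subseteq> V" "F \<subseteq> E" "F \<subseteq> W \<times> W" "sym F"
  shows "finite_graph W F"
  using assms finV irreflE finite_subset by unfold_locales (auto simp: irrefl_def)

text \<open>\<open>E\<close> holds both orientations of an edge; hence the factor 2, and
  \<open>3n - 5\<close> edges appear below as \<open>6n - 10\<close>.\<close>

lemma card_remove_vertex:
  "card (E \<inter> (V - {y}) \<times> (V - {y})) + 2 * card (E `` {y}) = card E"
proof -
  let ?F = "E \<inter> (V - {y}) \<times> (V - {y})"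
  have N: "finite (E `` {y})" using finE by (rule finite_Image)
  have E: "E = ?F \<union> ({y} \<times> E `` {y} \<union> E `` {y} \<times> {y})"
    using E_sym EV by auto
  have "card E = card ?F + card ({y} \<times> E `` {y} \<union> E `` {y} \<times> {y})"
    by (subst E, rule card_Un_disjoint) (use N finE in auto)
  also have "card ({y} \<times> E `` {y} \<union> E `` {y} \<times> {y}) = card ({y} \<times> E `` {y}) + card (E `` {y} \<times> {y})"
    by (rule card_Un_disjoint) (use N in auto)
  finally show ?thesis by (simp add: card_cartesian_product)
qed

text \<open>\<open>W\<close> collects the neighbours that \<open>x\<close> gains from
  \<open>y\<close>; leaving out those it already has makes the union disjoint and easy to
  count.\<close>

definition contract :: "'a \<Rightarrow> 'a \<Rightarrow> 'a rel" where
  "contract x y = (let W = E `` {y} - {x} - E `` {x} in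
    (E \<inter> (V - {y}) \<times> (V - {y})) \<union> {x} \<times> W \<union> W \<times> {x})"

lemma finite_graph_contract:
  assumes "(x, y) \<in> E"
  shows "finite_graph (V - {y}) (contract x y)"
proof
  have xy: "x \<noteq> y" "x \<in> V" using assms EV by auto
  show "finite (V - {y})" using finV by simp
  show "contract x y \<subseteq> (V - {y}) \<times> (V - {y})"
    using EV xy by (auto simp: contract_def Let_def)
  show "sym (contract x y)"
    by (rule symI) (auto simp: contract_def Let_def intro: E_sym)
  show "irrefl (contract x y)"
    by (auto simp: contract_def Let_def irrefl_def)
qed

text \<open>Contraction loses the edge itself and merges two edges into one at each common
  neighbour, in both orientations.\<close>

lemma card_contract:
  assumes "(x, y) \<in> E"
  shows "card (contract x y) + 2 + 2 * card (E `` {x} \<inter> E `` {y}) = card E"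
proof -
  define W where "W = E `` {y} - {x} - E `` {x}"
  have N: "finite (E `` {x})" "finite (E `` {y})" using finE by (auto intro: finite_Image)
  then have W: "finite W" by (simp add: W_def)
  let ?F = "E \<inter> (V - {y}) \<times> (V - {y})"
  have "card (contract x y) = card (?F \<union> {x} \<times> W) + card (W \<times> {x})"
    unfolding contract_def Let_def W_def[symmetric]
    by (rule card_Un_disjoint) (use finE W in \<open>auto simp: W_def dest: E_sym\<close>)
  also have "card (?F \<union> {x} \<times> W) = card ?F + card ({x} \<times> W)"
    by (rule card_Un_disjoint) (use finE W in \<open>auto simp: W_def\<close>)
  finally have 1: "card (contract x y) = card ?F + 2 * card W"
    by (simp add: card_cartesian_product)
  have "E `` {y} = insert x (W \<union> (E `` {x} \<inter> E `` {y}))"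
    using assms E_sym by (auto simp: W_def)
  moreover have "card (insert x (W \<union> (E `` {x} \<inter> E `` {y}))) = Suc (card (W \<union> (E `` {x} \<inter> E `` {y})))"
    using W N by (subst card_insert_disjoint) (auto simp: W_def)
  moreover have "card (W \<union> (E `` {x} \<inter> E `` {y})) = card W + card (E `` {x} \<inter> E `` {y})"
    by (rule card_Un_disjoint) (use W N in \<open>auto simp: W_def\<close>)
  ultimately show ?thesis
    using 1 card_remove_vertex[of y] by simp
qed

text \<open>Branch sets are pulled back along the map sending \<open>y\<close> to \<open>x\<close>.
  A cut of a lifted set either separates \<open>x\<close> from \<open>y\<close>, and their edge
  crosses it, or is a union of fibres and comes from a cut of the original set.\<close>

lemma k33_minor_contract:
  assumes xy: "(x, y) \<in> E" and minor: "k33_minor (V - {y}) (contract x y)"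
  shows "k33_minor V E"
proof -
  define f where "f v = (if v = y then x else v)" for v
  define lift where "lift S = {v\<in>V. f v \<in> S}" for S
  have pre: "\<exists>a' b'. f a' = a \<and> f b' = b \<and> (a', b') \<in> E \<and> a' \<in> V \<and> b' \<in> V"
    if ab: "(a, b) \<in> contract x y" for a b
  proof -
    consider "(a, b) \<in> E" "a \<noteq> y" "b \<noteq> y" | "a = x" "(y, b) \<in> E" | "b = x" "(y, a) \<in> E"
      using ab unfolding contract_def Let_def by blast
    then show ?thesis
    proof cases
      case 1 then show ?thesis using EV by (intro exI[of _ a] exI[of _ b]) (auto simp: f_def)
    next
      case 2
      then have "b \<noteq> y" by auto
      with 2 show ?thesis using EV by (intro exI[of _ y] exI[of _ b]) (auto simp: f_def)
    next
      case 3
      then have "a \<noteq> y" by auto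
      with 3 show ?thesis using EV E_sym[OF 3(2)] by (intro exI[of _ a] exI[of _ y]) (auto simp: f_def)
    qed
  qed
  have touch: "touching E (lift A) (lift B)" if "touching (contract x y) A B" for A B
    using that pre by (fastforce simp: touching_def lift_def)
  have conn: "conn E (lift S)" if S: "conn (contract x y) S" "S \<subseteq> V - {y}" for S
    unfolding conn_def
  proof (intro conjI allI impI)
    have sub: "S \<subseteq> lift S"
      using S(2) by (auto simp: lift_def f_def)
    then show "lift S \<noteq> {}" using S(1) by (auto simp: conn_def)
    fix T
    assume T: "T \<subseteq> lift S" "T \<noteq> {}" "T \<noteq> lift S"
    show "\<exists>a\<in>T. \<exists>b\<in>lift S - T. (a, b) \<in> E"
    proof (cases "x \<in> lift S \<and> (x \<in> T \<longleftrightarrow> y \<notin> T)")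
      case True
      moreover from True have "y \<in> lift S"
        using xy EV by (auto simp: lift_def f_def split: if_splits)
      ultimately show ?thesis
        using xy E_sym[OF xy] by (cases "x \<in> T") blast+
    next
      case False
      have sat: "u \<in> T \<longleftrightarrow> w \<in> T" if "f u = f w" "u \<in> lift S" "w \<in> lift S" for u w
        using that False xy EV by (auto simp: f_def lift_def split: if_splits)
      have "f ` T \<subseteq> S" "f ` T \<noteq> {}" using T by (auto simp: lift_def)
      moreover have "f ` T \<noteq> S"
      proof
        assume eq: "f ` T = S"
        have "v \<in> T" if v: "v \<in> lift S" for v
        proof -
          have "f v \<in> f ` T" using v eq by (simp add: lift_def)
          then obtain u where "u \<in> T" "f u = f v" by auto
          with sat[of u v] v T(1) show ?thesis by auto
        qed
        with T(1,3) show False by blast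
      qed
      ultimately obtain a b where ab: "a \<in> f ` T" "b \<in> S - f ` T" "(a, b) \<in> contract x y"
        using S(1) unfolding conn_def by meson
      obtain a' b' where p: "f a' = a" "f b' = b" "(a', b') \<in> E" "a' \<in> V" "b' \<in> V"
        using pre[OF ab(3)] by blast
      obtain u where u: "u \<in> T" "f u = a" using ab(1) by auto
      have "a' \<in> lift S" "b' \<in> lift S"
        using p ab T(1) by (auto simp: lift_def)
      with sat[of u a'] u p T(1) ab(2) have "a' \<in> T" "b' \<in> lift S - T" by auto
      with p(3) show ?thesis by blast
    qed
  qed
  obtain A B where AB: "k33_model (V - {y}) (contract x y) A B"
    using minor by (auto simp: k33_minor_def)
  have disj: "lift A \<inter> lift B = {}" if "A \<inter> B = {}" for A B
    using that by (auto simp: lift_def)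
  have sub: "lift S \<subseteq> V" for S by (auto simp: lift_def)
  have "k33_model V E (\<lambda>i. lift (A i)) (\<lambda>i. lift (B i))"
    unfolding k33_model_def
  proof (intro conjI allI impI)
    fix i j :: nat
    assume i: "i < 3"
    have "conn (contract x y) (A i)" "A i \<subseteq> V - {y}" "conn (contract x y) (B i)" "B i \<subseteq> V - {y}"
      using AB i by (simp_all add: k33_model_def)
    then show "conn E (lift (A i))" "conn E (lift (B i))"
      by (blast intro: conn)+
    show "lift (A i) \<subseteq> V" "lift (B i) \<subseteq> V" by (rule sub)+
    assume j: "j < 3"
    have "A i \<inter> B j = {}" "touching (contract x y) (A i) (B j)"
      using AB i j by (simp_all add: k33_model_def)
    then show "lift (A i) \<inter> lift (B j) = {}" "touching E (lift (A i)) (lift (B j))"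
      by (simp_all add: disj touch)
    assume "i \<noteq> j"
    then have "A i \<inter> A j = {}" "B i \<inter> B j = {}"
      using AB i j by (simp_all add: k33_model_def)
    then show "lift (A i) \<inter> lift (A j) = {}" "lift (B i) \<inter> lift (B j) = {}"
      by (simp_all add: disj)
  qed
  then show ?thesis by (auto simp: k33_minor_def)
qed

section \<open>Degree sums, components and gluing\<close>

lemma card_eq_sum_degree: "card E = (\<Sum>v\<in>V. card (E `` {v}))"
proof -
  have "E = Sigma V (\<lambda>v. E `` {v})" using EV by auto
  moreover have "card (Sigma V (\<lambda>v. E `` {v})) = (\<Sum>v\<in>V. card (E `` {v}))"
    using finV finE by (intro card_SigmaI) (auto intro: finite_Image)
  ultimately show ?thesis by metis
qed

lemma sym_restrict: "sym (E \<inter> W \<times> W)"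
  by (rule symI) (auto intro: E_sym)

lemma finite_graph_restrict: "W \<subseteq> V \<Longrightarrow> finite_graph W (E \<inter> W \<times> W)"
  by (rule finite_graph_subset) (auto intro: sym_restrict)

text \<open>A closed set of least size is connected: a part with no edge to the remainder would be a
  smaller closed set.\<close>

lemma exists_component:
  assumes "W \<subseteq> V" "W \<noteq> {}"
  shows "\<exists>C\<subseteq>W. conn E C \<and> (\<forall>c\<in>C. \<forall>u\<in>W. (c, u) \<in> E \<longrightarrow> u \<in> C)"
proof -
  define closed where "closed C \<longleftrightarrow> C \<subseteq> W \<and> C \<noteq> {} \<and> (\<forall>c\<in>C. \<forall>u\<in>W. (c, u) \<in> E \<longrightarrow> u \<in> C)" for C
  have "closed W" using assms(2) by (auto simp: closed_def)
  then obtain C where C: "closed C" "\<And>D. closed D \<Longrightarrow> card C \<le> card D"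
    using ex_has_least_nat[of closed W card] by blast
  have finC: "finite C"
    using C(1) assms(1) by (intro finite_subset[OF _ finV]) (auto simp: closed_def)
  have "conn E C"
    unfolding conn_def
  proof (intro conjI allI impI)
    show "C \<noteq> {}" using C(1) by (simp add: closed_def)
    fix T
    assume T: "T \<subseteq> C" "T \<noteq> {}" "T \<noteq> C"
    then have "card T < card C" using finC by (simp add: psubset_card_mono psubset_eq)
    then have "\<not> closed T" using C(2)[of T] by auto
    then obtain t u where "t \<in> T" "u \<in> W" "(t, u) \<in> E" "u \<notin> T"
      using T C(1) by (auto simp: closed_def)
    then show "\<exists>a\<in>T. \<exists>b\<in>C - T. (a, b) \<in> E"
      using T(1) C(1) unfolding closed_def by blast
  qed
  then show ?thesis using C(1) by (auto simp: closed_def)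
qed

text \<open>For 2 and for 5 vertices this is exactly the bound \<open>6n - 10\<close>, and it
  settles these cases of the density theorem.\<close>

lemma card_edges_le: "card E + card V \<le> card V * card V"
proof -
  have "E \<inter> Id_on V = {}" by (auto simp: irreflE)
  then have "card (E \<union> Id_on V) = card E + card (Id_on V)"
    using finE finV by (intro card_Un_disjoint) (auto simp: Id_on_def)
  moreover have "card (Id_on V) = card V"
    unfolding Id_on_def by (simp add: card_image inj_on_def UNION_singleton_eq_range)
  moreover have "card (E \<union> Id_on V) \<le> card (V \<times> V)"
    using EV finV by (intro card_mono) auto
  ultimately show ?thesis by (simp add: card_cartesian_product)
qed

text \<open>Both pieces contain the edge between \<open>a\<close> and \<open>b\<close>, in both
  orientations. The saving of 2 makes \<open>6n - 10\<close> stable under gluing: the orders add up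
  to \<open>n + 2\<close>, and 12 - 20 - 2 = -10.\<close>

lemma card_glue:
  assumes C: "C \<subseteq> V" and ab: "a \<in> V - C" "b \<in> V - C" "(a, b) \<in> E"
    and att: "\<And>c u. c \<in> C \<Longrightarrow> (c, u) \<in> E \<Longrightarrow> u \<in> C \<union> {a, b}"
  shows "card E + 2 \<le> card (E \<inter> (C \<union> {a, b}) \<times> (C \<union> {a, b})) + card (E \<inter> (V - C) \<times> (V - C))"
proof -
  let ?F1 = "E \<inter> (C \<union> {a, b}) \<times> (C \<union> {a, b})" and ?F2 = "E \<inter> (V - C) \<times> (V - C)"
  have "E \<subseteq> ?F1 \<union> ?F2"
  proof (rule subrelI)
    fix u w
    assume e: "(u, w) \<in> E"
    then show "(u, w) \<in> ?F1 \<union> ?F2"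
      using att[of u w] att[of w u] E_sym[OF e] EV by blast
  qed
  then have "?F1 \<union> ?F2 = E" by blast
  then have "card ?F1 + card ?F2 = card E + card (?F1 \<inter> ?F2)"
    using card_Un_Int[of ?F1 ?F2] finE by simp
  moreover have "a \<noteq> b" using ab(3) by auto
  then have "card {(a, b), (b, a)} = 2" by simp
  moreover have "card {(a, b), (b, a)} \<le> card (?F1 \<inter> ?F2)"
    using ab E_sym finE by (intro card_mono) auto
  ultimately show ?thesis by simp
qed

end

lemma exists_four_set:
  assumes "card N = 4" "A \<subseteq> N" "3 \<le> card A"
  obtains a b c d where "N = {a, b, c, d}" "distinct [a, b, c, d]" "{a, b, c} \<subseteq> A"
proof -
  obtain T where T: "T \<subseteq> A" "card T = 3"
    using obtain_subset_with_card_n[OF assms(3)] by metis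
  have "finite N" using assms(1) card.infinite by fastforce
  then have "finite T" using T assms finite_subset by (meson order_trans)
  then have "card (N - T) = 1" using T assms by (subst card_Diff_subset) auto
  then obtain d where "N - T = {d}" by (auto simp: card_1_singleton_iff)
  moreover obtain a b c where "T = {a, b, c}" "distinct [a, b, c]"
    using T(2) by (auto simp: card_3_iff)
  ultimately show ?thesis
    using that[of a b c d] T assms by auto
qed

text \<open>
  In a smallest counterexample, contracting an edge shows that its ends have three common
  neighbours. Hence a vertex of degree at most five has degree four or five; degree five gives a
  \<open>K\<^sub>3\<^sub>,\<^sub>3\<close> subgraph, and for degree four the neighbourhood is a clique, so that a component of the
  rest either completes a \<open>K\<^sub>3\<^sub>,\<^sub>3\<close> model or can be split off along an edge.
\<close>
theorem edges_le_if_no_k33_minor: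
  assumes "finite_graph V F" "\<not> k33_minor V F" "2 \<le> card V"
  shows "card F + 10 \<le> 6 * card V"
  using assms
proof (induction "card V + card F" arbitrary: V F rule: less_induct)
  case less
  interpret finite_graph V F by fact
  show ?case
  proof (rule ccontr)
    assume not: "\<not> ?thesis"
    define n where "n = card V"
    have lower: "6 * n \<le> card F + 9" using not by (simp add: n_def)
    have n3: "3 \<le> n"
    proof (rule ccontr)
      assume "\<not> 3 \<le> n"
      then have "n = 2" using less.prems(3) by (simp add: n_def)
      then show False using card_edges_le lower by (simp add: n_def)
    qed
    have IH: "card F' + 10 \<le> 6 * card V'"
      if "finite_graph V' F'" "V' \<subseteq> V" "F' \<subseteq> F" "2 \<le> card V'" "card V' < card V" for V' F'
    proof (rule less.hyps)
      have "card F' \<le> card F" using that(3) finE by (rule card_mono[rotated])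
      then show "card V' + card F' < card V + card F" using that(5) by simp
      show "\<not> k33_minor V' F'" using less.prems(2) k33_minor_mono that(2,3) by blast
    qed (use that in auto)
    \<comment> \<open>Deleting an edge lowers the count by 2 at the same \<open>n\<close>, so a
      smallest counterexample exceeds the bound by at most 2; its average degree is therefore below
      6.\<close>
    have upper: "card F + 8 \<le> 6 * n"
    proof (rule ccontr)
      assume big: "\<not> ?thesis"
      then obtain x y where xy: "(x, y) \<in> F" using n3 by (cases "F = {}") auto
      define F' where "F' = F - {(x, y), (y, x)}"
      have "x \<noteq> y" using xy by auto
      then have "card F' + 2 = card F"
        using xy E_sym[OF xy] finE card_mono[of F "{(x, y), (y, x)}"]
        by (simp add: F'_def card_Diff_subset)
      moreover have "finite_graph V F'"
        by (rule finite_graph_subset) (use EV in \<open>auto simp: F'_def intro!: symI dest: E_sym\<close>)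
      moreover have "\<not> k33_minor V F'"
        using less.prems(2) k33_minor_mono[of V F' V F] by (auto simp: F'_def)
      ultimately have "card F' + 10 \<le> 6 * card V"
        using less.prems(3) by (intro less.hyps) auto
      with \<open>card F' + 2 = card F\<close> big show False by (simp add: n_def)
    qed
    \<comment> \<open>With \<open>c\<close> common neighbours, contraction lowers the count by
      \<open>2 + 2c\<close> and the bound by 6. The original is over the bound and the contraction
      is not, so \<open>2 + 2c > 6\<close>.\<close>
    have common: "3 \<le> card (F `` {x} \<inter> F `` {y})" if xy: "(x, y) \<in> F" for x y
    proof -
      have y: "y \<in> V" using xy EV by auto
      have c: "card (contract x y) + 2 + 2 * card (F `` {x} \<inter> F `` {y}) = card F"
        by (rule card_contract[OF xy])
      have cV: "card (V - {y}) + 1 = n"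
        using y finV n3 by (simp add: n_def)
      have "card (contract x y) + 10 \<le> 6 * card (V - {y})"
      proof (rule less.hyps)
        show "card (V - {y}) + card (contract x y) < card V + card F"
          using c cV by (simp add: n_def)
        show "finite_graph (V - {y}) (contract x y)" by (rule finite_graph_contract[OF xy])
        show "\<not> k33_minor (V - {y}) (contract x y)"
          using k33_minor_contract[OF xy] less.prems(2) by blast
      qed (use cV n3 in simp)
      with c cV lower show ?thesis by simp
    qed
    have "\<exists>v\<in>V. card (F `` {v}) \<le> 5"
    proof (rule ccontr)
      assume no: "\<not> ?thesis"
      have "6 \<le> card (F `` {v})" if "v \<in> V" for v
      proof -
        have "\<not> card (F `` {v}) \<le> 5" using no that by blast
        then show ?thesis by simp
      qed
      then have "6 * n \<le> card F"
        using sum_mono[of V "\<lambda>_. 6" "\<lambda>v. card (F `` {v})"] card_eq_sum_degree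
        by (simp add: n_def mult.commute)
      with upper n3 show False by simp
    qed
    then obtain v where v: "v \<in> V" "card (F `` {v}) \<le> 5" by blast
    define N where "N = F `` {v}"
    have finN: "finite N" using finE by (auto simp: N_def intro: finite_Image)
    have N: "N \<subseteq> V" "v \<notin> N" "\<And>x. x \<in> N \<Longrightarrow> (v, x) \<in> F" using EV by (auto simp: N_def)
    have N_nbrs: "3 \<le> card (N \<inter> F `` {u})" if "u \<in> N" for u
      using common[of v u] that by (simp add: N_def)
    have "N \<noteq> {}"
    proof
      assume "N = {}"
      then have "F \<subseteq> (V - {v}) \<times> (V - {v})" using EV E_sym by (auto simp: N_def)
      then have "finite_graph (V - {v}) F"
        using symE by (intro finite_graph_subset) auto
      then have "card F + 10 \<le> 6 * card (V - {v})"
        using v(1) finV n3 by (intro IH) (auto simp: n_def)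
      then show False using lower v(1) finV n3 by (simp add: n_def)
    qed
    have remove: "N \<inter> F `` {u} \<subseteq> N - {u}" for u by auto
    have cN: "card N = 4 \<or> card N = 5"
    proof -
      obtain u where u: "u \<in> N" using \<open>N \<noteq> {}\<close> by blast
      have "3 \<le> card (N - {u})"
        using N_nbrs[OF u] card_mono[OF _ remove] finN by (meson finite_Diff le_trans)
      then show ?thesis using u v(2) finN by (simp add: N_def) linarith
    qed
    then show False
    proof
      assume 5: "card N = 5"
      \<comment> \<open>Each vertex of \<open>N\<close> misses at most one of the other four, so two
        nonadjacent ones are both joined to the remaining three; without such a pair
        \<open>N\<close> is a clique and any two serve. With \<open>v\<close> they form one side of
        a \<open>K33\<close>.\<close>
      obtain a b where ab: "a \<in> N" "b \<in> N" "a \<noteq> b"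
        "(a, b) \<notin> F \<or> (\<forall>x\<in>N. \<forall>y\<in>N. x \<noteq> y \<longrightarrow> (x, y) \<in> F)"
      proof (cases "\<exists>x\<in>N. \<exists>y\<in>N. x \<noteq> y \<and> (x, y) \<notin> F")
        case True
        then show ?thesis using that by blast
      next
        case False
        moreover obtain a b where "a \<in> N" "b \<in> N" "a \<noteq> b"
        proof -
          have "2 \<le> card N" using 5 by simp
          then obtain T where "T \<subseteq> N" "card T = 2" using obtain_subset_with_card_n by metis
          then show ?thesis using that by (auto simp: card_2_iff)
        qed
        ultimately show ?thesis using that by blast
      qed
      have cR: "card (N - {a, b}) = 3" using ab(1-3) 5 finN by (simp add: card_Diff_subset)
      have adj: "(a, x) \<in> F \<and> (b, x) \<in> F" if x: "x \<in> N - {a, b}" for x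
      proof (cases "(a, b) \<in> F")
        case True
        with ab x show ?thesis by auto
      next
        case False
        then have "N \<inter> F `` {a} \<subseteq> N - {a, b}" "N \<inter> F `` {b} \<subseteq> N - {a, b}"
          using E_sym by auto
        moreover have "N \<inter> F `` {c} = N - {a, b}" if "c \<in> N" "N \<inter> F `` {c} \<subseteq> N - {a, b}" for c
          by (rule card_seteq) (use that N_nbrs[of c] cR finN in auto)
        ultimately have "N \<inter> F `` {a} = N - {a, b}" "N \<inter> F `` {b} = N - {a, b}"
          using ab(1,2) by blast+
        with x show ?thesis by blast
      qed
      obtain x y z where xyz: "N - {a, b} = {x, y, z}" "x \<noteq> y" "y \<noteq> z" "x \<noteq> z"
        using cR unfolding card_3_iff by blast
      have in_N: "w \<in> N" "w \<noteq> a" "w \<noteq> b" if "w \<in> {x, y, z}" for w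
        using that xyz(1) by blast+
      have "k33_minor V F"
      proof (rule k33_minorI[of F "{v}" V a b x y z])
        show "touching F {v} {w} \<and> (a, w) \<in> F \<and> (b, w) \<in> F" if "w \<in> {x, y, z}" for w
          using in_N[OF that] adj[of w] N(3)[of w] by (auto simp: touching_def)
      qed (use in_N[of x] in_N[of y] in_N[of z] ab N v(1) xyz in auto)
      with less.prems(2) show False ..
    next
      assume 4: "card N = 4"
      have clique: "(x, y) \<in> F" if "x \<in> N" "y \<in> N" "x \<noteq> y" for x y
      proof -
        have "N \<inter> F `` {x} = N - {x}"
          using N_nbrs[OF that(1)] 4 that(1) finN remove[of x] by (intro card_seteq) auto
        with that show ?thesis by blast
      qed
      define W where "W = V - N - {v}"
      show False
      proof (cases "W = {}")
        case True
        then have "V = insert v N" using N v(1) by (auto simp: W_def)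
        then have "n = 5" using 4 N(2) finN by (simp add: n_def)
        then show False using card_edges_le lower by (simp add: n_def)
      next
        case False
        obtain C where C: "C \<subseteq> W" "conn F C" "\<And>c u. c \<in> C \<Longrightarrow> u \<in> W \<Longrightarrow> (c, u) \<in> F \<Longrightarrow> u \<in> C"
        proof -
          have "W \<subseteq> V" by (auto simp: W_def)
          from exists_component[OF this False] show ?thesis using that by blast
        qed
        have CV: "C \<subseteq> V" "v \<notin> C" "C \<inter> N = {}" using C(1) by (auto simp: W_def)
        have finC: "finite C" using CV(1) finV finite_subset by blast
        have "C \<noteq> {}" using C(2) by (auto simp: conn_def)
        define A where "A = {u\<in>N. touching F C {u}}"
        show False
        proof (cases "3 \<le> card A")
          case True
          obtain a b c d where abcd: "N = {a, b, c, d}" "distinct [a, b, c, d]" "{a, b, c} \<subseteq> A"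
          proof -
            have "A \<subseteq> N" by (auto simp: A_def)
            from exists_four_set[OF 4 this True] show ?thesis using that by blast
          qed
          have "k33_minor V F"
          proof (rule k33_minorI[of F C V v d a b c])
            show "touching F C {x} \<and> (v, x) \<in> F \<and> (d, x) \<in> F" if "x \<in> {a, b, c}" for x
              using that abcd clique[of d x] N(3)[of x] by (auto simp: A_def)
          qed (use C(2) CV N v(1) abcd in auto)
          with less.prems(2) show False ..
        next
          case False
          have "A \<subseteq> N" by (auto simp: A_def)
          moreover have "card A \<le> 2" using False by simp
          \<comment> \<open>Even if \<open>C\<close> attaches to fewer than two vertices of
            \<open>N\<close>, padding to exactly two gives an edge to split along, since
            \<open>N\<close> is a clique.\<close>
          ultimately obtain B where B: "A \<subseteq> B" "B \<subseteq> N" "card B = 2"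
            using exists_subset_between[of A 2 N] finN 4 by auto
          then obtain a b where ab: "B = {a, b}" "a \<noteq> b" by (auto simp: card_2_iff)
          have abN: "a \<in> N" "b \<in> N" using ab B by auto
          have att: "u \<in> C \<union> {a, b}" if "c \<in> C" "(c, u) \<in> F" for c u
          proof -
            have "u \<noteq> v" using that CV N E_sym by (auto simp: N_def)
            moreover have "u \<in> V" using that EV by auto
            moreover have "u \<in> A" if "u \<in> N"
              using that \<open>c \<in> C\<close> \<open>(c, u) \<in> F\<close> by (auto simp: A_def touching_def)
            ultimately show ?thesis
              using C(3)[OF that(1), of u] that(2) B(1) ab(1) by (auto simp: W_def)
          qed
          have glue: "card F + 2 \<le> card (F \<inter> (C \<union> {a, b}) \<times> (C \<union> {a, b})) + card (F \<inter> (V - C) \<times> (V - C))"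
            by (rule card_glue[OF CV(1) _ _ clique[OF abN ab(2)] att]) (use abN N CV in auto)
          have sub: "C \<union> {a, b} \<subseteq> V" using CV abN N by auto
          have c1: "card (C \<union> {a, b}) = card C + 2"
            using finC CV(3) abN ab(2) by (subst card_Un_disjoint) auto
          have "v \<notin> C \<union> {a, b}" using CV(2) N(2) abN by auto
          then have "C \<union> {a, b} \<subset> V" using sub v(1) by blast
          then have "card (C \<union> {a, b}) < card V" using finV by (rule psubset_card_mono[rotated])
          then have 1: "card (F \<inter> (C \<union> {a, b}) \<times> (C \<union> {a, b})) + 10 \<le> 6 * (card C + 2)"
            using IH[OF finite_graph_restrict[OF sub] sub] c1 by simp
          have c2: "card (V - C) + card C = n"
            using finV CV(1) finC by (simp add: n_def card_Diff_subset card_mono)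
          have "{a, b} \<subseteq> V - C" using abN N CV(3) by auto
          then have "2 \<le> card (V - C)" using ab(2) finV card_mono[of "V - C" "{a, b}"] by simp
          moreover have "card C > 0" using \<open>C \<noteq> {}\<close> finC by (simp add: card_gt_0_iff)
          ultimately have 2: "card (F \<inter> (V - C) \<times> (V - C)) + 10 \<le> 6 * card (V - C)"
            using c2 by (intro IH finite_graph_restrict) (auto simp: n_def)
          from glue 1 2 c2 lower show False by simp
        qed
      qed
    qed
  qed
qed

lemma darts_less_if_no_k33_minor:
  assumes "finite_graph V F" "\<not> k33_minor V F" "S \<subseteq> V" "S \<noteq> {}"
  shows "darts F S < 6 * card S"
proof -
  interpret finite_graph V F by fact
  interpret S: finite_graph S "F \<inter> S \<times> S" by (rule finite_graph_restrict[OF assms(3)])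
  have "nbrs F S v = (F \<inter> S \<times> S) `` {v}" if "v \<in> S" for v
    using that by (auto simp: nbrs_def)
  then have d: "darts F S = card (F \<inter> S \<times> S)"
    unfolding S.card_eq_sum_degree darts_def by (intro sum.cong) auto
  show ?thesis
  proof (cases "2 \<le> card S")
    case True
    have "\<not> k33_minor S (F \<inter> S \<times> S)"
      using assms(2,3) k33_minor_mono[of S _ V F] by blast
    from edges_le_if_no_k33_minor[OF S.finite_graph_axioms this True] d show ?thesis by simp
  next
    case False
    moreover have "0 < card S" using assms(4) S.finV by (simp add: card_gt_0_iff)
    ultimately have "card S = 1" by simp
    with S.card_edges_le d show ?thesis by simp
  qed
qed

section \<open>Theta curves\<close>

text \<open>The closed curve \<open>J\<close> of \<open>c1\<close> and \<open>c2\<close> has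
  \<open>Z\<close> on one side \<open>D\<close>. As \<open>c3\<close> meets the closure of
  \<open>Z\<close>, it runs in \<open>D\<close> too, so the other side \<open>D'\<close> avoids it.
  Neither \<open>c1\<close> with \<open>c3\<close> nor \<open>c2\<close> with \<open>c3\<close>
  separates \<open>Z\<close> from \<open>D'\<close>, and these two sets meet in the connected
  \<open>c3\<close>; by Janiszewski their union does not separate either, although it contains
  \<open>J\<close>.\<close>

lemma no_common_side_of_theta:
  fixes c1 c2 c3 :: "real \<Rightarrow> complex"
  assumes arcs: "Path_Connected.arc c1" "Path_Connected.arc c2" "Path_Connected.arc c3"
    and start: "pathstart c1 = p" "pathstart c2 = p" "pathstart c3 = p"
    and fin: "pathfinish c1 = q" "pathfinish c2 = q" "pathfinish c3 = q"
    and int: "path_image c1 \<inter> path_image c2 = {p, q}" "path_image c1 \<inter> path_image c3 = {p, q}"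
      "path_image c2 \<inter> path_image c3 = {p, q}"
    and Z: "Topological_Spaces.connected Z" "Z \<inter> (path_image c1 \<union> path_image c2 \<union> path_image c3) = {}"
    and meets: "x1 \<in> closure Z" "x1 \<in> path_image c1" "x2 \<in> closure Z" "x2 \<in> path_image c2"
      "x3 \<in> closure Z" "x3 \<in> path_image c3" "{x1, x2, x3} \<inter> {p, q} = {}"
  shows False
proof -
  define J where "J = path_image c1 \<union> path_image c2"
  have pq: "p \<in> J" "q \<in> J" using int(1) by (auto simp: J_def)
  have loop: "simple_path (c1 +++ reversepath c2)"
    by (rule simple_path_join_loop) (use arcs start fin int(1) in \<open>auto simp: arc_reversepath\<close>)
  have img: "path_image (c1 +++ reversepath c2) = J"
    using start fin by (simp add: path_image_join J_def)
  obtain D1 D2 where D12: "D1 \<noteq> {}" "open D1" "Topological_Spaces.connected D1" "D2 \<noteq> {}" "open D2" "Topological_Spaces.connected D2"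
    "D1 \<inter> D2 = {}" "D1 \<union> D2 = - J" "frontier D1 = J" "frontier D2 = J"
    using Jordan_curve[OF loop] start fin img by (metis pathfinish_join pathstart_join pathfinish_reversepath)
  have "Z \<noteq> {}" using meets(1) by auto
  have "Z \<subseteq> D1 \<union> D2" using Z(2) D12(8) by (auto simp: J_def)
  moreover have "D1 \<inter> D2 \<inter> Z = {}" using D12(7) by auto
  ultimately have "D1 \<inter> Z = {} \<or> D2 \<inter> Z = {}"
    using connectedD[OF Z(1) D12(2,5)] by blast
  then obtain D D' where D: "Z \<subseteq> D" "open D" "D' \<noteq> {}" "open D'" "Topological_Spaces.connected D'" "D \<inter> D' = {}"
    "D \<union> D' = - J" "frontier D = J" "frontier D' = J"
  proof
    assume "D1 \<inter> Z = {}"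
    then have "Z \<subseteq> D2" using \<open>Z \<subseteq> D1 \<union> D2\<close> by blast
    then show ?thesis
      using that[of D2 D1] D12 by (simp add: Int_commute Un_commute)
  next
    assume "D2 \<inter> Z = {}"
    then have "Z \<subseteq> D1" using \<open>Z \<subseteq> D1 \<union> D2\<close> by blast
    then show ?thesis
      using that[of D1 D2] D12 by simp
  qed
  have "closure Z \<subseteq> D \<union> J"
    using closure_mono[OF D(1)] D(8) closure_Un_frontier[of D] by simp
  then have "x3 \<in> D \<or> x3 \<in> J" using meets(5) by blast
  then have x3: "x3 \<in> D"
    using meets(6,7) int(2,3) by (auto simp: J_def)
  define I where "I = path_image c3 - {p, q}"
  have "Topological_Spaces.connected I"
    using connected_simple_path_endless[OF arc_imp_simple_path[OF arcs(3)]] start fin by (simp add: I_def)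
  moreover have IJ: "I \<subseteq> D \<union> D'" using D(7) int(2,3) by (auto simp: I_def J_def)
  moreover have "D \<inter> D' \<inter> I = {}" using D(6) by auto
  moreover have "D \<inter> I \<noteq> {}" using x3 meets(6,7) by (auto simp: I_def)
  ultimately have "D' \<inter> I = {}" using connectedD[OF _ D(2,4), of I] by blast
  then have D'c3: "D' \<inter> path_image c3 = {}" using pq D(7) by (auto simp: I_def)
  obtain z z' where z: "z \<in> Z" "z' \<in> D'" using \<open>Z \<noteq> {}\<close> D(3) by blast
  \<comment> \<open>A small ball about \<open>x\<close>, a boundary point of \<open>D'\<close> and a
    limit of \<open>Z\<close>, bridges the two sets.\<close>
  have avoid: "connected_component (- S) z z'"
    if S: "closed S" "S \<inter> Z = {}" "S \<inter> D' = {}" "x \<in> closure Z" "x \<in> J" "x \<notin> S" for S x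
  proof -
    obtain e where e: "e > 0" "ball x e \<subseteq> - S"
      using S(1,6) open_contains_ball[of "- S"] by (auto simp: open_Compl)
    have "x \<in> closure D'" using S(5) D(9) by (auto simp: frontier_def)
    then have "ball x e \<inter> D' \<noteq> {}" "ball x e \<inter> Z \<noteq> {}"
      using S(4) e(1) unfolding closure_approachable by (force simp: dist_commute)+
    then have "Topological_Spaces.connected (Z \<union> ball x e)" "Topological_Spaces.connected ((Z \<union> ball x e) \<union> D')"
      using Z(1) D(5) by (auto intro!: connected_Un)
    then show ?thesis
      using z S(2,3) e(2) by (intro connected_componentI[of "(Z \<union> ball x e) \<union> D'"]) auto
  qed
  have cl: "closed (path_image c)" if "Path_Connected.arc c" for c :: "real \<Rightarrow> complex"
    using that by (simp add: arc_imp_path closed_path_image)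
  have D'J: "D' \<inter> J = {}" using D(7) by auto
  have x2: "x2 \<notin> path_image c1 \<union> path_image c3" and x1: "x1 \<notin> path_image c2 \<union> path_image c3"
    using meets(2,4,7) int by blast+
  have "connected_component (- ((path_image c1 \<union> path_image c3) \<union> (path_image c2 \<union> path_image c3))) z z'"
  proof (rule Janiszewski)
    show "compact (path_image c1 \<union> path_image c3)" "closed (path_image c2 \<union> path_image c3)"
      using arcs cl by (auto simp: compact_Un compact_path_image arc_imp_path closed_Un)
    have "(path_image c1 \<union> path_image c3) \<inter> (path_image c2 \<union> path_image c3) = path_image c3"
      using int by auto
    then show "Topological_Spaces.connected ((path_image c1 \<union> path_image c3) \<inter> (path_image c2 \<union> path_image c3))"
      using arcs(3) by (simp add: connected_path_image arc_imp_path)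
    show "connected_component (- (path_image c1 \<union> path_image c3)) z z'"
      by (rule avoid[where x = x2])
        (use arcs cl Z(2) D'c3 D'J meets(1-4) x2 in \<open>auto simp: J_def closed_Un\<close>)
    show "connected_component (- (path_image c2 \<union> path_image c3)) z z'"
      by (rule avoid[where x = x1])
        (use arcs cl Z(2) D'c3 D'J meets(1-4) x1 in \<open>auto simp: J_def closed_Un\<close>)
  qed
  then have "connected_component (- J) z z'"
    by (rule connected_component_of_subset) (auto simp: J_def)
  then obtain T where T: "Topological_Spaces.connected T" "T \<subseteq> - J" "z \<in> T" "z' \<in> T"
    by (auto simp: connected_component_def)
  then show False
    using connectedD[OF T(1) D(2,4)] D(1,6,7) z by blast
qed

text \<open>The arc without its end is the image of a half-open interval. It allows a connection to
  stop just before its landing point and still touch it in the closure.\<close>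

lemma
  fixes g :: "real \<Rightarrow> 'a::t2_space"
  assumes "Path_Connected.arc g"
  shows connected_arc_minus_finish: "Topological_Spaces.connected (path_image g - {pathfinish g})"
    and finish_in_closure_arc: "pathfinish g \<in> closure (path_image g - {pathfinish g})"
proof -
  have cont: "continuous_on {0..1} g" and inj: "inj_on g {0..1}"
    using assms by (auto simp: arc_def path_def)
  have eq: "path_image g - {pathfinish g} = g ` {0..<1}"
    using inj by (auto simp: path_image_def pathfinish_def inj_on_def less_le)
  have "continuous_on {0..<1} g" using cont by (rule continuous_on_subset) auto
  then show "Topological_Spaces.connected (path_image g - {pathfinish g})"
    unfolding eq by (rule connected_continuous_image) (rule convex_connected, simp)
  have "g ` closure {0..<1} \<subseteq> closure (g ` {0..<1})"
    by (rule image_closure_subset) (use cont in \<open>auto simp: closure_subset\<close>)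
  then show "pathfinish g \<in> closure (path_image g - {pathfinish g})"
    unfolding eq by (auto simp: pathfinish_def)
qed

section \<open>Drawings exclude K33 minors\<close>

context finite_graph
begin

section \<open>Paths in connected vertex sets\<close>

definition lpath :: "'a set \<Rightarrow> 'a \<Rightarrow> 'a \<Rightarrow> 'a list \<Rightarrow> bool" where
  "lpath S x y xs \<longleftrightarrow> xs \<noteq> [] \<and> hd xs = x \<and> last xs = y \<and> distinct xs \<and> set xs \<subseteq> S \<and>
    successively (\<lambda>u v. (u, v) \<in> E) xs"

lemma lpath_mono: "lpath S x y xs \<Longrightarrow> S \<subseteq> S' \<Longrightarrow> lpath S' x y xs"
  by (auto simp: lpath_def)

lemma lpath_ends: "lpath S x y xs \<Longrightarrow> x \<in> set xs \<and> y \<in> set xs"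
  by (auto simp: lpath_def)

lemma lpath_rev: "lpath S x y xs \<Longrightarrow> lpath S y x (rev xs)"
  using E_sym by (auto simp: lpath_def hd_rev last_rev elim!: successively_mono)

lemma lpath_append:
  assumes "lpath S x y xs" "lpath S' y' z ys" "(y, y') \<in> E" "set xs \<inter> set ys = {}"
  shows "lpath (S \<union> S') x z (xs @ ys)"
  using assms by (auto simp: lpath_def successively_append_iff)

lemma lpath_split:
  assumes "lpath S x y (as @ z # bs)"
  shows "lpath S x z (as @ [z])" "lpath S z y (z # bs)"
  using assms by (auto simp: lpath_def successively_append_iff hd_append split: if_splits)

lemma lpath_first_hit:
  assumes "lpath S x y xs" "y \<in> C"
  obtains t ys where "t \<in> C" "lpath S x t ys" "set ys \<inter> C = {t}" "set ys \<subseteq> set xs"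
proof -
  have "\<exists>v\<in>set xs. v \<in> C" using assms lpath_ends by blast
  then obtain as t bs where xs: "xs = as @ t # bs" "t \<in> C" "\<forall>v\<in>set as. v \<notin> C"
    using split_list_first_prop[of xs "\<lambda>v. v \<in> C"] by blast
  show ?thesis
    by (rule that[of t "as @ [t]"]) (use xs assms lpath_split(1) in auto)
qed

lemma lpath_exists:
  assumes S: "conn E S" "x \<in> S" "y \<in> S"
  obtains xs where "lpath S x y xs"
proof -
  define T where "T = {z\<in>S. \<exists>xs. lpath S x z xs}"
  have "lpath S x x [x]" using S by (auto simp: lpath_def)
  then have xT: "x \<in> T" using S by (auto simp: T_def)
  have "T = S"
  proof (rule ccontr)
    assume "T \<noteq> S"
    moreover have "T \<subseteq> S" "T \<noteq> {}" using xT by (auto simp: T_def)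
    ultimately obtain a b where ab: "a \<in> T" "b \<in> S - T" "(a, b) \<in> E"
      using S(1) unfolding conn_def by meson
    obtain xs where xs: "lpath S x a xs" using ab(1) by (auto simp: T_def)
    have "\<exists>ys. lpath S x b ys"
    proof (cases "b \<in> set xs")
      case True
      then obtain as bs where "xs = as @ b # bs" by (meson split_list)
      with xs lpath_split(1) show ?thesis by blast
    next
      case False
      have "lpath S b b [b]" using ab by (auto simp: lpath_def)
      from lpath_append[OF xs this ab(3)] False show ?thesis by auto
    qed
    with ab(2) show False by (auto simp: T_def)
  qed
  then show ?thesis using S(3) that by (auto simp: T_def)
qed

text \<open>Join two of the points by a path and follow a path from the third to its first hit, the
  centre \<open>p\<close>. The points may coincide, so legs may be single vertices. This reduces a
  branch set with three exits to a subdivided claw.\<close>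

lemma tripod:
  assumes S: "conn E S" and x: "\<And>i::nat. i < 3 \<Longrightarrow> x i \<in> S"
  obtains p g where "p \<in> S" "\<And>i. i < 3 \<Longrightarrow> lpath S p (x i) (g i)"
    "\<And>i j. i < 3 \<Longrightarrow> j < 3 \<Longrightarrow> i \<noteq> j \<Longrightarrow> set (g i) \<inter> set (g j) = {p}"
proof -
  obtain P where P: "lpath S (x 0) (x 1) P" using lpath_exists[OF S x x, of 0 1] by auto
  obtain Q where Q: "lpath S (x 2) (x 0) Q" using lpath_exists[OF S x x, of 2 0] by auto
  obtain p R where R: "p \<in> set P" "lpath S (x 2) p R" "set R \<inter> set P = {p}"
    using lpath_first_hit[OF Q, of "set P"] lpath_ends[OF P] by metis
  obtain as bs where P': "P = as @ p # bs" using R(1) by (meson split_list)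
  define g where "g = (\<lambda>i::nat. if i = 0 then rev (as @ [p]) else if i = 1 then p # bs else rev R)"
  have g: "g 0 = rev (as @ [p])" "g 1 = p # bs" "g 2 = rev R" by (auto simp: g_def)
  have pS: "p \<in> S" using R(1) P by (auto simp: lpath_def)
  have l: "lpath S p (x 0) (g 0)" "lpath S p (x 1) (g 1)" "lpath S p (x 2) (g 2)"
    unfolding g using lpath_split[of S "x 0" "x 1" as p bs] P P' lpath_rev R(2) by blast+
  have "distinct P" using P by (simp add: lpath_def)
  then have d: "set (g 0) \<inter> set (g 1) = {p}" "set (g 0) \<inter> set (g 2) = {p}" "set (g 1) \<inter> set (g 2) = {p}"
    using R(3) unfolding g P' by auto
  have "\<forall>i<3. lpath S p (x i) (g i)" unfolding all_less_3 using l by simp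
  moreover have "\<forall>i<3. \<forall>j<3. i \<noteq> j \<longrightarrow> set (g i) \<inter> set (g j) = {p}"
    unfolding all_less_3 using d by (simp add: Int_commute)
  ultimately show ?thesis using that[OF pS] by blast
qed

fun edge_sets :: "'a list \<Rightarrow> 'a set set" where
  "edge_sets (x # y # r) = insert {x, y} (edge_sets (y # r))"
| "edge_sets _ = {}"

lemma edge_setsD:
  "e \<in> edge_sets xs \<Longrightarrow> successively (\<lambda>u v. (u, v) \<in> E) xs \<Longrightarrow>
    \<exists>u v. e = {u, v} \<and> (u, v) \<in> E \<and> u \<in> set xs \<and> v \<in> set xs"
  by (induction xs rule: edge_sets.induct) auto

text \<open>An edge joining both ends of a repetition-free path leaves no room for inner vertices.
  Hence two theta arcs with inner vertices cannot share the edge between their common ends.\<close>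

lemma edge_sets_ends:
  assumes "distinct xs" "{hd xs, last xs} \<in> edge_sets xs"
  shows "length xs = 2"
proof (cases xs rule: edge_sets.cases)
  case (1 x y r)
  have sub: "e \<subseteq> set ys" if "e \<in> edge_sets ys" for e and ys :: "'a list"
    using that by (induction ys rule: edge_sets.induct) auto
  have "{hd xs, last xs} \<notin> edge_sets (y # r)"
    using sub[of "{hd xs, last xs}" "y # r"] assms(1) 1 by auto
  then have "{x, last xs} = {x, y}" using assms(2) 1 by simp
  then have "last xs = y" using assms(1) 1 by (auto simp: doubleton_eq_iff)
  then show ?thesis using 1 assms(1) last_in_set[of r] by (cases r) auto
qed (use assms in auto)

end

locale drawn_graph = finite_graph V E for V :: "'a set" and E +
  fixes pos :: "'a \<Rightarrow> complex" and \<gamma> :: "'a set \<Rightarrow> real \<Rightarrow> complex"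
  assumes inj_pos: "inj_on pos V"
    and arc_edge: "(u, v) \<in> E \<Longrightarrow> Path_Connected.arc (\<gamma> {u, v})"
    and ends_edge: "(u, v) \<in> E \<Longrightarrow> {pathstart (\<gamma> {u, v}), pathfinish (\<gamma> {u, v})} = {pos u, pos v}"
    and disjoint_edges: "(u, v) \<in> E \<Longrightarrow> (x, y) \<in> E \<Longrightarrow> {u, v} \<noteq> {x, y} \<Longrightarrow>
      path_image (\<gamma> {u, v}) \<inter> path_image (\<gamma> {x, y}) \<subseteq> pos ` ({u, v} \<inter> {x, y})"
begin

section \<open>From paths of the graph to arcs in the plane\<close>

definition img :: "'a list \<Rightarrow> complex set" where
  "img xs = (\<Union>e\<in>edge_sets xs. path_image (\<gamma> e))"

lemma edge_arc:
  assumes "(u, v) \<in> E"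
  obtains c where "Path_Connected.arc c" "pathstart c = pos u" "pathfinish c = pos v"
    "path_image c = path_image (\<gamma> {u, v})"
proof (cases "pathstart (\<gamma> {u, v}) = pos u")
  case True
  then have "pathfinish (\<gamma> {u, v}) = pos v"
    using ends_edge[OF assms] by (auto simp: doubleton_eq_iff)
  with True show ?thesis using that[of "\<gamma> {u, v}"] arc_edge[OF assms] by simp
next
  case False
  then have "pathfinish (\<gamma> {u, v}) = pos u" "pathstart (\<gamma> {u, v}) = pos v"
    using ends_edge[OF assms] by (auto simp: doubleton_eq_iff)
  then show ?thesis
    using that[of "reversepath (\<gamma> {u, v})"] arc_edge[OF assms] by (simp add: arc_reversepath)
qed

lemma img_inter:
  assumes "successively (\<lambda>u v. (u, v) \<in> E) xs" "successively (\<lambda>u v. (u, v) \<in> E) ys"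
    and "edge_sets xs \<inter> edge_sets ys = {}"
  shows "img xs \<inter> img ys \<subseteq> pos ` (set xs \<inter> set ys)"
proof
  fix z
  assume "z \<in> img xs \<inter> img ys"
  then obtain e e' where e: "e \<in> edge_sets xs" "e' \<in> edge_sets ys"
    "z \<in> path_image (\<gamma> e)" "z \<in> path_image (\<gamma> e')" by (auto simp: img_def)
  obtain u v where uv: "e = {u, v}" "(u, v) \<in> E" "u \<in> set xs" "v \<in> set xs"
    using edge_setsD[OF e(1) assms(1)] by blast
  obtain x y where xy: "e' = {x, y}" "(x, y) \<in> E" "x \<in> set ys" "y \<in> set ys"
    using edge_setsD[OF e(2) assms(2)] by blast
  have "e \<noteq> e'" using e(1,2) assms(3) by auto
  then have "z \<in> pos ` ({u, v} \<inter> {x, y})"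
    using disjoint_edges[OF uv(2) xy(2)] e(3,4) uv(1) xy(1) by blast
  then show "z \<in> pos ` (set xs \<inter> set ys)" using uv xy by auto
qed

text \<open>Edge arcs are concatenated. The first vertex does not recur, so the first edge is not in
  the tail and the pieces meet only at their joint. A single vertex draws no arc, whence the length
  condition.\<close>

lemma lpath_arc:
  assumes "lpath S x y xs" "2 \<le> length xs"
  obtains c where "Path_Connected.arc c" "pathstart c = pos x" "pathfinish c = pos y" "path_image c = img xs"
proof -
  have "\<exists>c. Path_Connected.arc c \<and> pathstart c = pos (hd xs) \<and> pathfinish c = pos (last xs) \<and>
      path_image c = img xs"
    if "distinct xs" "successively (\<lambda>u v. (u, v) \<in> E) xs" "2 \<le> length xs" for xs
    using that
  proof (induction xs rule: edge_sets.induct)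
    case (1 x y r)
    have xy: "(x, y) \<in> E" using 1 by simp
    obtain c where c: "Path_Connected.arc c" "pathstart c = pos x" "pathfinish c = pos y"
      "path_image c = path_image (\<gamma> {x, y})" using edge_arc[OF xy] .
    show ?case
    proof (cases r)
      case Nil
      with c show ?thesis by (intro exI[of _ c]) (simp add: img_def)
    next
      case (Cons z s)
      then obtain d where d: "Path_Connected.arc d" "pathstart d = pos y" "pathfinish d = pos (last (y # r))"
        "path_image d = img (y # r)" using 1 by auto
      have "edge_sets [x, y] \<inter> edge_sets (y # r) = {}"
      proof -
        have "{x, y} \<notin> edge_sets (y # r)"
          using edge_setsD[of "{x, y}" "y # r"] 1(2,3) by (auto simp: doubleton_eq_iff)
        then show ?thesis by simp
      qed
      then have "img [x, y] \<inter> img (y # r) \<subseteq> pos ` (set [x, y] \<inter> set (y # r))"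
        using 1(3) by (intro img_inter) auto
      moreover have "set [x, y] \<inter> set (y # r) = {y}" using 1(2) by auto
      ultimately have "img [x, y] \<inter> img (y # r) \<subseteq> pos ` {y}"
        by (simp only:)
      moreover have "img [x, y] = path_image c" by (simp add: img_def c(4))
      ultimately have "path_image c \<inter> path_image d \<subseteq> {pathstart d}"
        using d(2,4) by simp
      then have "Path_Connected.arc (c +++ d)" using c d by (intro arc_join) auto
      moreover have "path_image (c +++ d) = img (x # y # r)"
        using c d by (simp add: path_image_join img_def)
      ultimately show ?thesis
        using c d by (intro exI[of _ "c +++ d"]) simp
    qed
  qed auto
  from this[of xs] assms that show ?thesis by (auto simp: lpath_def)
qed

text \<open>\<open>A 0\<close> and \<open>A 1\<close> give the ends \<open>p\<close> and
  \<open>q\<close> of a theta curve with one arc through each \<open>B j\<close>. From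
  \<open>A 2\<close>, connections reach all three arcs; cut off before landing, they form a
  connected set as excluded by \<open>no_common_side_of_theta\<close>.\<close>

theorem no_k33_minor: "\<not> k33_minor V E"
proof
  assume "k33_minor V E"
  then obtain A B where AB: "k33_model V E A B" by (auto simp: k33_minor_def)
  have A: "A i \<subseteq> V" "conn E (A i)" and B: "B i \<subseteq> V" "conn E (B i)" if "i < 3" for i
    using AB that by (simp_all add: k33_model_def)
  have AA: "A i \<inter> A j = {}" and BB: "B i \<inter> B j = {}" if "i < 3" "j < 3" "i \<noteq> j" for i j
    using AB that by (simp_all add: k33_model_def)
  have AB0: "A i \<inter> B j = {}" and "touching E (A i) (B j)" if "i < 3" "j < 3" for i j
    using AB that by (simp_all add: k33_model_def)
  then have "\<forall>i j. \<exists>a b. i < 3 \<longrightarrow> j < 3 \<longrightarrow> a \<in> A i \<and> b \<in> B j \<and> (a, b) \<in> E"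
    by (fastforce simp: touching_def)
  then obtain a b where ab: "a i j \<in> A i" "b i j \<in> B j" "(a i j, b i j) \<in> E" if "i < 3" "j < 3" for i j
    by metis
  obtain p g where g: "p \<in> A 0" "\<And>j. j < 3 \<Longrightarrow> lpath (A 0) p (a 0 j) (g j)"
    "\<And>i j. i < 3 \<Longrightarrow> j < 3 \<Longrightarrow> i \<noteq> j \<Longrightarrow> set (g i) \<inter> set (g j) = {p}"
    using tripod[OF A(2), of 0 "a 0"] ab(1) by auto
  obtain q h where h: "q \<in> A 1" "\<And>j. j < 3 \<Longrightarrow> lpath (A 1) q (a 1 j) (h j)"
    "\<And>i j. i < 3 \<Longrightarrow> j < 3 \<Longrightarrow> i \<noteq> j \<Longrightarrow> set (h i) \<inter> set (h j) = {q}"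
    using tripod[OF A(2), of 1 "a 1"] ab(1) by auto
  have "\<exists>m. lpath (B j) (b 0 j) (b 1 j) m" if j: "j < 3" for j
  proof -
    obtain r where "lpath (B j) (b 0 j) (b 1 j) r"
      using lpath_exists[OF B(2)[OF j] ab(2)[of 0 j] ab(2)[of 1 j]] j by auto
    then show ?thesis by blast
  qed
  then obtain m where m: "lpath (B j) (b 0 j) (b 1 j) (m j)" if "j < 3" for j by metis
  \<comment> \<open>Inside \<open>A 2\<close> the three paths may overlap: a common start is all
    that keeps their union connected, so no tripod is built.\<close>
  have "\<exists>l. lpath (A 2) (a 2 0) (a 2 j) l" if j: "j < 3" for j
  proof -
    obtain r where "lpath (A 2) (a 2 0) (a 2 j) r"
      using lpath_exists[OF A(2)[of 2] ab(1)[of 2 0] ab(1)[of 2 j]] j by auto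
    then show ?thesis by blast
  qed
  then obtain l where l: "lpath (A 2) (a 2 0) (a 2 j) (l j)" if "j < 3" for j by metis
  \<comment> \<open>Stopping at the first vertex \<open>t j\<close> on \<open>m j\<close> keeps the
    connection off the theta arc until its end.\<close>
  have "\<exists>t s. t \<in> set (m j) \<and> lpath (B j) (b 2 j) t s \<and> set s \<inter> set (m j) = {t}" if j: "j < 3" for j
  proof -
    have e: "b 0 j \<in> set (m j)" using lpath_ends[OF m[OF j]] by simp
    obtain r where "lpath (B j) (b 2 j) (b 0 j) r"
      using lpath_exists[OF B(2)[OF j] ab(2)[of 2 j] ab(2)[of 0 j]] j by auto
    from lpath_first_hit[OF this e] show ?thesis by metis
  qed
  then obtain t s where s: "t j \<in> set (m j)" "lpath (B j) (b 2 j) (t j) (s j)"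
    "set (s j) \<inter> set (m j) = {t j}" if "j < 3" for j by metis
  define C where "C j = g j @ m j @ rev (h j)" for j
  define w where "w j = l j @ s j" for j
  have sub: "set (g j) \<subseteq> A 0" "set (h j) \<subseteq> A 1" "set (l j) \<subseteq> A 2" "set (m j) \<subseteq> B j" "set (s j) \<subseteq> B j"
    if "j < 3" for j
    using that g(2) h(2) l m s(2) by (auto simp: lpath_def)
  have pg: "p \<in> set (g j)" "q \<in> set (h j)" "a 2 0 \<in> set (l j)" if "j < 3" for j
    using that lpath_ends g(2) h(2) l by blast+
  have C: "lpath V p q (C j)" if j: "j < 3" for j
  proof -
    have 1: "lpath (B j \<union> A 1) (b 0 j) q (m j @ rev (h j))"
    proof (rule lpath_append[OF m[OF j] lpath_rev[OF h(2)[OF j]]])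
      show "(b 1 j, a 1 j) \<in> E" using ab(3)[of 1 j] j by (auto intro: E_sym)
      show "set (m j) \<inter> set (rev (h j)) = {}" using sub[OF j] AB0[of 1 j] j by auto
    qed
    have "lpath (A 0 \<union> (B j \<union> A 1)) p q (C j)"
      unfolding C_def
    proof (rule lpath_append[OF g(2)[OF j] 1])
      show "(a 0 j, b 0 j) \<in> E" using ab(3)[of 0 j] j by auto
      show "set (g j) \<inter> set (m j @ rev (h j)) = {}"
        using sub[OF j] AB0[of 0 j] AA[of 0 1] j by auto
    qed
    then show ?thesis by (rule lpath_mono) (use A B j in auto)
  qed
  have w: "lpath V (a 2 0) (t j) (w j)" if j: "j < 3" for j
  proof -
    have "lpath (A 2 \<union> B j) (a 2 0) (t j) (w j)"
      unfolding w_def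
    proof (rule lpath_append[OF l[OF j] s(2)[OF j]])
      show "(a 2 j, b 2 j) \<in> E" using ab(3)[of 2 j] j by auto
      show "set (l j) \<inter> set (s j) = {}" using sub[OF j] AB0[of 2 j] j by auto
    qed
    then show ?thesis by (rule lpath_mono) (use A B j in auto)
  qed
  have succ: "successively (\<lambda>u v. (u, v) \<in> E) (C j)" "successively (\<lambda>u v. (u, v) \<in> E) (w j)" if "j < 3" for j
    using C[OF that] w[OF that] by (auto simp: lpath_def)
  have CC: "set (C i) \<inter> set (C j) = {p, q}" if "i < 3" "j < 3" "i \<noteq> j" for i j
  proof -
    note s1 = sub[OF that(1)] and s2 = sub[OF that(2)]
    have "set (g i) \<inter> set (m j) = {}"
      using s1(1) s2(4) AB0[of 0 j] that(1,2) by (simp; blast)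
    moreover have "set (g i) \<inter> set (h j) = {}"
      using s1(1) s2(2) AA[of 0 1] that(1,2) by (simp; blast)
    moreover have "set (h i) \<inter> set (m j) = {}"
      using s1(2) s2(4) AB0[of 1 j] that(1,2) by (simp; blast)
    moreover have "set (h i) \<inter> set (g j) = {}"
      using s1(2) s2(1) AA[of 1 0] that(1,2) by (simp; blast)
    moreover have "set (m i) \<inter> set (g j) = {}"
      using s1(4) s2(1) AB0[of 0 i] that(1,2) by (simp; blast)
    moreover have "set (m i) \<inter> set (h j) = {}"
      using s1(4) s2(2) AB0[of 1 i] that(1,2) by (simp; blast)
    moreover have "set (m i) \<inter> set (m j) = {}"
      using s1(4) s2(4) BB[OF that] by blast
    ultimately show ?thesis
      using g(3)[OF that] h(3)[OF that] unfolding C_def by auto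
  qed
  have wC: "set (w i) \<inter> set (C j) \<subseteq> {t i}" if "i < 3" "j < 3" for i j
  proof -
    note s1 = sub[OF that(1)] and s2 = sub[OF that(2)]
    have "set (l i) \<inter> set (g j) = {}"
      using s1(3) s2(1) AA[of 2 0] that(1,2) by (simp; blast)
    moreover have "set (l i) \<inter> set (h j) = {}"
      using s1(3) s2(2) AA[of 2 1] that(1,2) by (simp; blast)
    moreover have "set (l i) \<inter> set (m j) = {}"
      using s1(3) s2(4) AB0[of 2 j] that(1,2) by (simp; blast)
    moreover have "set (s i) \<inter> set (g j) = {}"
      using s1(5) s2(1) AB0[of 0 i] that(1,2) by (simp; blast)
    moreover have "set (s i) \<inter> set (h j) = {}"
      using s1(5) s2(2) AB0[of 1 i] that(1,2) by (simp; blast)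
    moreover have "set (s i) \<inter> set (m j) \<subseteq> {t i}"
    proof (cases "i = j")
      case True
      with s(3)[OF that(1)] show ?thesis by auto
    next
      case False
      then show ?thesis using sub[OF that(1)] sub[OF that(2)] BB[OF that] by blast
    qed
    ultimately show ?thesis unfolding w_def C_def by auto
  qed
  have long: "2 \<le> length (w j)" "3 \<le> length (C j)" if j: "j < 3" for j
  proof -
    have "l j \<noteq> []" "s j \<noteq> []" "g j \<noteq> []" "m j \<noteq> []" "h j \<noteq> []"
      using l[OF j] s(2)[OF j] g(2)[OF j] m[OF j] h(2)[OF j] by (auto simp: lpath_def)
    then have "1 \<le> length (l j)" "1 \<le> length (s j)" "1 \<le> length (g j)" "1 \<le> length (m j)" "1 \<le> length (h j)"
      by (auto simp: Suc_le_eq)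
    then show "2 \<le> length (w j)" "3 \<le> length (C j)" by (simp_all add: w_def C_def)
  qed
  have pqE: "{p, q} \<notin> edge_sets (C j)" if "j < 3" for j
    using edge_sets_ends[of "C j"] C[OF that] long(2)[OF that] by (auto simp: lpath_def)
  have edges_CC: "edge_sets (C i) \<inter> edge_sets (C j) = {}" if ij: "i < 3" "j < 3" "i \<noteq> j" for i j
  proof (rule ccontr)
    assume "\<not> ?thesis"
    then obtain e where e: "e \<in> edge_sets (C i)" "e \<in> edge_sets (C j)" by blast
    obtain u v where uv: "e = {u, v}" "(u, v) \<in> E" "u \<in> set (C i)" "v \<in> set (C i)"
      using edge_setsD[OF e(1) succ(1)[OF ij(1)]] by blast
    obtain u' v' where "e = {u', v'}" "u' \<in> set (C j)" "v' \<in> set (C j)"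
      using edge_setsD[OF e(2) succ(1)[OF ij(2)]] by blast
    then have "u \<in> {p, q}" "v \<in> {p, q}" using uv CC[OF ij] by (auto simp: doubleton_eq_iff)
    moreover have "u \<noteq> v" using uv(2) by auto
    ultimately have "e = {p, q}" using uv(1) by auto
    with e(1) pqE[OF ij(1)] show False by simp
  qed
  have edges_wC: "edge_sets (w i) \<inter> edge_sets (C j) = {}" if ij: "i < 3" "j < 3" for i j
  proof (rule ccontr)
    assume "\<not> ?thesis"
    then obtain e where e: "e \<in> edge_sets (w i)" "e \<in> edge_sets (C j)" by blast
    obtain u v where uv: "e = {u, v}" "(u, v) \<in> E" "u \<in> set (w i)" "v \<in> set (w i)"
      using edge_setsD[OF e(1) succ(2)[OF ij(1)]] by blast
    obtain u' v' where "e = {u', v'}" "u' \<in> set (C j)" "v' \<in> set (C j)"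
      using edge_setsD[OF e(2) succ(1)[OF ij(2)]] by blast
    then have "u = t i" "v = t i" using uv wC[OF ij] by (auto simp: doubleton_eq_iff)
    with uv(2) show False by simp
  qed
  have "\<exists>c. Path_Connected.arc c \<and> pathstart c = pos p \<and> pathfinish c = pos q \<and> path_image c = img (C j)"
    if "j < 3" for j
    using lpath_arc[OF C[OF that]] long(2)[OF that] by (metis Suc_leD numeral_3_eq_3 numeral_2_eq_2)
  then obtain c where c: "Path_Connected.arc (c j)" "pathstart (c j) = pos p" "pathfinish (c j) = pos q"
    "path_image (c j) = img (C j)" if "j < 3" for j by metis
  have "\<exists>d. Path_Connected.arc d \<and> pathstart d = pos (a 2 0) \<and> pathfinish d = pos (t j) \<and> path_image d = img (w j)"
    if "j < 3" for j
    using lpath_arc[OF w[OF that] long(1)[OF that]] by metis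
  then obtain d where d: "Path_Connected.arc (d j)" "pathstart (d j) = pos (a 2 0)" "pathfinish (d j) = pos (t j)"
    "path_image (d j) = img (w j)" if "j < 3" for j by metis
  have cc: "path_image (c i) \<inter> path_image (c j) = {pos p, pos q}" if ij: "i < 3" "j < 3" "i \<noteq> j" for i j
  proof
    show "path_image (c i) \<inter> path_image (c j) \<subseteq> {pos p, pos q}"
      using img_inter[OF succ(1)[OF ij(1)] succ(1)[OF ij(2)] edges_CC[OF ij]] CC[OF ij] c(4) ij(1,2) by simp
    show "{pos p, pos q} \<subseteq> path_image (c i) \<inter> path_image (c j)"
      using c(2,3) ij pathstart_in_path_image pathfinish_in_path_image by (metis IntI empty_subsetI insert_subset)
  qed
  define D where "D j = path_image (d j) - {pos (t j)}" for j
  have Dc: "D i \<inter> path_image (c j) = {}" if ij: "i < 3" "j < 3" for i j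
    using img_inter[OF succ(2)[OF ij(1)] succ(1)[OF ij(2)] edges_wC[OF ij]] wC[OF ij] c(4)[OF ij(2)] d(4)[OF ij(1)]
    by (auto simp: D_def)
  have tB: "t j \<in> B j" "t j \<in> V" if "j < 3" for j
    using s(1)[OF that] sub[OF that] B(1)[OF that] by auto
  have D: "Topological_Spaces.connected (D j)" "pos (t j) \<in> closure (D j)" "pos (a 2 0) \<in> D j" if j: "j < 3" for j
  proof -
    show "Topological_Spaces.connected (D j)" "pos (t j) \<in> closure (D j)"
      using connected_arc_minus_finish[OF d(1)[OF j]] finish_in_closure_arc[OF d(1)[OF j]] d(3)[OF j]
      by (simp_all add: D_def)
    have "a 2 0 \<in> A 2" using ab(1)[of 2 0] by simp
    then have "a 2 0 \<noteq> t j" "a 2 0 \<in> V" using tB[OF j] AB0[of 2 j] A(1)[of 2] j by auto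
    then have "pos (a 2 0) \<noteq> pos (t j)" using tB[OF j] inj_pos by (auto simp: inj_on_def)
    then show "pos (a 2 0) \<in> D j"
      using pathstart_in_path_image[of "d j"] d(2)[OF j] by (simp add: D_def)
  qed
  define Z where "Z = D 0 \<union> D 1 \<union> D 2"
  have "Topological_Spaces.connected Z"
    unfolding Z_def using D[of 0] D[of 1] D[of 2] by (auto intro!: connected_Un)
  moreover have "Z \<inter> (path_image (c 0) \<union> path_image (c 1) \<union> path_image (c 2)) = {}"
  proof -
    have "\<forall>i<3. \<forall>j<3. D i \<inter> path_image (c j) = {}" using Dc by blast
    then show ?thesis unfolding all_less_3 Z_def by blast
  qed
  moreover have cl: "pos (t j) \<in> closure Z" if j: "j < 3" for j
  proof -
    have "\<forall>i<3. D i \<subseteq> Z" unfolding all_less_3 Z_def by blast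
    then have "D j \<subseteq> Z" using j by blast
    with D(2)[OF j] closure_mono show ?thesis by blast
  qed
  moreover have tc: "pos (t j) \<in> path_image (c j)" "pos (t j) \<notin> {pos p, pos q}" if j: "j < 3" for j
  proof -
    show "pos (t j) \<notin> {pos p, pos q}"
    proof -
      have "p \<noteq> t j" "q \<noteq> t j"
        using tB(1)[OF j] g(1) h(1) AB0[of 0 j] AB0[of 1 j] j by (simp; blast)+
      moreover have "p \<in> V" "q \<in> V" using g(1) h(1) A(1)[of 0] A(1)[of 1] by auto
      ultimately show ?thesis
        using inj_on_eq_iff[OF inj_pos tB(2)[OF j]] by auto
    qed
    show "pos (t j) \<in> path_image (c j)"
    proof -
      have "t j \<in> set (C j)" using s(1)[OF j] by (simp add: C_def)
      moreover have "pos v \<in> img xs" if "v \<in> set xs" "2 \<le> length xs"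
        "successively (\<lambda>u v. (u, v) \<in> E) xs" for v xs
        using that
      proof (induction xs rule: edge_sets.induct)
        case (1 x y r)
        have "pos x \<in> path_image (\<gamma> {x, y})" "pos y \<in> path_image (\<gamma> {x, y})"
          using ends_edge[of x y] 1(4) pathstart_in_path_image[of "\<gamma> {x, y}"]
            pathfinish_in_path_image[of "\<gamma> {x, y}"] by (auto simp: doubleton_eq_iff)
        then show ?case
          using 1 by (cases r) (auto simp: img_def)
      qed auto
      ultimately show ?thesis
        using c(4)[OF j] long(2)[OF j] succ(1)[OF j] by simp
    qed
  qed
  ultimately show False
    using no_common_side_of_theta[of "c 0" "c 1" "c 2" "pos p" "pos q" Z "pos (t 0)" "pos (t 1)" "pos (t 2)"]
      c cc by simp
qed

end

section \<open>Planar graphs\<close>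

text \<open>\<open>reach\<close> admits moves that change nothing, while adjacent colourings must
  differ; such moves are dropped, so the walk may be shorter than \<open>m\<close>.\<close>

lemma reconf_walk:
  fixes G :: "('a,'b) pre_digraph"
  assumes "graph G" "finite_graph (verts G) (arcs_ends G)"
    and "finite_graph.reach (verts G) (arcs_ends G) k m \<alpha> \<beta>"
  shows "\<exists>l \<sigma>. l \<le> m \<and> \<sigma> 0 = \<alpha> \<and> \<sigma> l = \<beta> \<and> (\<forall>i\<le>l. \<sigma> i \<in> colorings k G) \<and>
    (\<forall>i<l. differ_at_one G (\<sigma> i) (\<sigma> (Suc i)))"
proof -
  interpret finite_graph "verts G" "arcs_ends G" by fact
  have cols: "cols k = colorings k G"
    by (auto simp: cols_def colorings_def)
  from assms(3) show ?thesis
  proof (induction rule: reach.induct)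
    case (refl \<phi> m)
    then show ?case
      by (intro exI[of _ 0] exI[of _ "\<lambda>_. \<phi>"]) (auto simp: cols)
  next
    case (step m \<phi> \<psi> v \<psi>' c)
    obtain l \<sigma> where \<sigma>: "l \<le> m" "\<sigma> 0 = \<phi>" "\<sigma> l = \<psi>" "\<forall>i\<le>l. \<sigma> i \<in> colorings k G"
      "\<forall>i<l. differ_at_one G (\<sigma> i) (\<sigma> (Suc i))"
      using step.IH by blast
    show ?case
    proof (cases "c = \<psi> v")
      case True
      then have "\<psi>' = \<psi>" using step.hyps by simp
      with \<sigma> show ?thesis by (intro exI[of _ l] exI[of _ \<sigma>]) auto
    next
      case False
      define \<tau> where "\<tau> i = (if i \<le> l then \<sigma> i else \<psi>')" for i
      have one: "differ_at_one G \<psi> \<psi>'"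
        using step.hyps(2,3) False by (auto simp: differ_at_one_def)
      have "\<psi>' \<in> colorings k G" using step.hyps by (simp add: cols)
      then have "\<forall>i\<le>Suc l. \<tau> i \<in> colorings k G" using \<sigma>(4) by (simp add: \<tau>_def)
      moreover have "differ_at_one G (\<tau> i) (\<tau> (Suc i))" if "i < Suc l" for i
      proof (cases "i = l")
        case True
        with one \<sigma>(3) show ?thesis by (simp add: \<tau>_def)
      next
        case False
        with that \<sigma>(5) show ?thesis by (simp add: \<tau>_def)
      qed
      ultimately show ?thesis
        using \<sigma>(1,2) by (intro exI[of _ "Suc l"] exI[of _ \<tau>]) (simp add: \<tau>_def)
    qed
  qed
qed

lemma reconf_distance_le:
  fixes G :: "('a,'b) pre_digraph"
  assumes "graph G" "\<forall>i\<le>m. \<sigma> i \<in> colorings k G" "\<forall>i<m. differ_at_one G (\<sigma> i) (\<sigma> (Suc i))"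
  shows "wf_digraph.\<mu> (reconf_graph k G) (\<lambda>_. 1) (\<sigma> 0) (\<sigma> m) \<le> ereal (real m)"
proof -
  interpret H: graph "reconf_graph k G" by (rule graph_reconf_graph[OF assms(1)])
  have V: "verts (reconf_graph k G) = colorings k G" by (simp add: reconf_graph_def)
  define p where "p = map (\<lambda>i. (\<sigma> i, \<sigma> (Suc i))) [0..<m]"
  have "H.awalk (\<sigma> 0) (map (\<lambda>i. (\<sigma> i, \<sigma> (Suc i))) [0..<j]) (\<sigma> j)" if "j \<le> m" for j
    using that
  proof (induction j)
    case 0
    with assms(2) show ?case by (simp add: H.awalk_Nil_iff V)
  next
    case (Suc j)
    have "(\<sigma> j, \<sigma> (Suc j)) \<in> arcs (reconf_graph k G)"
      using Suc.prems assms(2,3) by (simp add: reconf_graph_def)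
    from H.arc_implies_awalk[OF this]
    have "H.awalk (\<sigma> j) [(\<sigma> j, \<sigma> (Suc j))] (\<sigma> (Suc j))"
      by (simp add: reconf_graph_def)
    then show ?case
      using Suc H.awalk_appendI by simp
  qed
  then have walk: "H.awalk (\<sigma> 0) p (\<sigma> m)" by (simp add: p_def)
  have "H.awalk_cost (\<lambda>_. 1) p = real (length p)" for p
    by (induction p) (simp_all add: H.awalk_cost_Nil H.awalk_cost_Cons)
  with H.min_cost_le_walk_cost[OF walk, of "\<lambda>_. 1"] show ?thesis
    by (simp add: p_def)
qed

lemma planar_graph_drawn:
  assumes "planar_graph G"
  obtains pos \<gamma> where "drawn_graph (verts G) (arcs_ends G) pos \<gamma>"
proof -
  obtain pos \<gamma> where d: "graph G" "plane_drawing G pos \<gamma>"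
    using assms by (auto simp: planar_graph_def)
  interpret graph G by fact
  have "finite_graph (verts G) (arcs_ends G)"
  proof
    show "irrefl (arcs_ends G)" by (auto simp: irrefl_def dest: adj_not_same)
    show "sym (arcs_ends G)" using sym_arcs by (simp add: symmetric_def)
  qed (auto dest: adj_in_verts)
  moreover have "drawn_graph_axioms (verts G) (arcs_ends G) pos \<gamma>"
    using d(2) by unfold_locales (auto simp: plane_drawing_def)
  ultimately show ?thesis using that by (simp add: drawn_graph_def)
qed

theorem theorem4:
  fixes G :: "('a,'b) pre_digraph" and n :: nat
  assumes "planar_graph G"
    and "card (verts G) = n"
  shows "graph_diameter (reconf_graph 10 G) \<le> ereal (8 * real n) \<and>
    (\<forall>\<alpha> \<in> colorings 10 G. \<forall>\<beta> \<in> colorings 10 G.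
       \<exists>m \<sigma>. m \<le> 8 * n \<and> \<sigma> 0 = \<alpha> \<and> \<sigma> m = \<beta> \<and>
         (\<forall>i\<le>m. \<sigma> i \<in> colorings 10 G) \<and>
         (\<forall>i<m. differ_at_one G (\<sigma> i) (\<sigma> (Suc i))))"
proof -
  have G: "graph G" using assms(1) by (simp add: planar_graph_def)
  obtain pos \<gamma> where "drawn_graph (verts G) (arcs_ends G) pos \<gamma>"
    using planar_graph_drawn[OF assms(1)] .
  then interpret drawn_graph "verts G" "arcs_ends G" pos \<gamma> .
  have cols: "cols 10 = colorings 10 G"
    by (auto simp: cols_def colorings_def)
  have reach: "reach 10 (8 * n) \<alpha> \<beta>" if "\<alpha> \<in> colorings 10 G" "\<beta> \<in> colorings 10 G" for \<alpha> \<beta>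
    using reach_8n darts_less_if_no_k33_minor[OF finite_graph_axioms no_k33_minor] that
    unfolding cols assms(2)[symmetric] by blast
  have seq: "\<exists>m \<sigma>. m \<le> 8 * n \<and> \<sigma> 0 = \<alpha> \<and> \<sigma> m = \<beta> \<and> (\<forall>i\<le>m. \<sigma> i \<in> colorings 10 G) \<and>
      (\<forall>i<m. differ_at_one G (\<sigma> i) (\<sigma> (Suc i)))"
    if "\<alpha> \<in> colorings 10 G" "\<beta> \<in> colorings 10 G" for \<alpha> \<beta>
    by (rule reconf_walk[OF G finite_graph_axioms reach[OF that]])
  have "wf_digraph.\<mu> (reconf_graph 10 G) (\<lambda>_. 1) \<alpha> \<beta> \<le> ereal (8 * real n)"
    if ab: "\<alpha> \<in> colorings 10 G" "\<beta> \<in> colorings 10 G" for \<alpha> \<beta>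
  proof -
    obtain m \<sigma> where m: "m \<le> 8 * n" "\<sigma> 0 = \<alpha>" "\<sigma> m = \<beta>" "\<forall>i\<le>m. \<sigma> i \<in> colorings 10 G"
      "\<forall>i<m. differ_at_one G (\<sigma> i) (\<sigma> (Suc i))"
      using seq[OF ab] by blast
    have "wf_digraph.\<mu> (reconf_graph 10 G) (\<lambda>_. 1) \<alpha> \<beta> \<le> ereal (real m)"
      using reconf_distance_le[OF G m(4,5)] m(2,3) by simp
    also have "\<dots> \<le> ereal (8 * real n)" using m(1) by simp
    finally show ?thesis .
  qed
  then have "graph_diameter (reconf_graph 10 G) \<le> ereal (8 * real n)"
    unfolding graph_diameter_def by (intro SUP_least) (auto simp: reconf_graph_def)
  with seq show ?thesis by blast
qed

end
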